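(* Let $G$ be a connected graph with maximum degree $\Delta(G) \geq 4$ that is not a complete graph. Let $P \subseteq V(G)$, and suppose that each vertex $v \in P$ is assigned a set $F(v) \subseteq \{1,\dots,\Delta(G)\}$ of forbidden colors. Suppose that at least one of the following holds: (i) $|F(v)| \leq \Delta(G)-2$ for every $v \in P$, and any two distinct vertices of $P$ are at distance at least $4$ in $G$; or (ii) $|F(v)| \leq \Delta(G)-3$ for every $v \in P$, and any two distinct vertices of $P$ are at distance at least $3$ in $G$. Then there is a proper vertex coloring $f$ of $G$ with colors $1,\dots,\Delta(G)$ such that $f(v) \notin F(v)$ for every $v \in P$.
   Context: Graphs are finite and simple. Distance is the length (number of edges) of a shortest path. *)

theory Defs
  imports "Graph_Theory.Graph_Theory"
begin

text \<open>A finite simple graph is a \<^locale>\<open>graph\<close> of the AFP entry Graph Theory: a finite symmetric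
  digraph without loops or parallel arcs. Every edge is a pair of opposite arcs, so the degree of a
  vertex is its out-degree.\<close>

definition max_degree :: "('a, 'b) pre_digraph \<Rightarrow> nat" where
  "max_degree G = Max (out_degree G ` verts G)"

definition complete_graph :: "('a, 'b) pre_digraph \<Rightarrow> bool" where
  "complete_graph G \<longleftrightarrow> (\<exists>n. complete_digraph n G)"

text \<open>Extended-real valued; it is \<open>\<infinity>\<close> between vertices in different components.\<close>

definition graph_dist :: "('a, 'b) pre_digraph \<Rightarrow> 'a \<Rightarrow> 'a \<Rightarrow> ereal" where
  "graph_dist G u v = wf_digraph.\<mu> G (\<lambda>_. 1) u v"

text \<open>The library takes the infimum over all walks; this agrees with the length of a shortest path.\<close>

lemma graph_dist_eq_shortest_path:
  assumes "wf_digraph G"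
  shows "graph_dist G u v = (INF p\<in>{p. pre_digraph.apath G u p v}. ereal (real (length p)))"
proof -
  interpret wf_digraph G by fact
  have cost: "awalk_cost (\<lambda>_. 1) p = real (length p)" for p
    by (induction p) simp_all
  show ?thesis
  proof (rule antisym)
    show "graph_dist G u v \<le> (INF p\<in>{p. apath u p v}. ereal (real (length p)))"
      unfolding graph_dist_def \<mu>_def cost by (rule INF_superset_mono) (auto simp: apath_def)
    have "(INF p\<in>{p. apath u p v}. ereal (real (length p))) \<le> ereal (real (length p))"
      if walk: "awalk u p v" for p
    proof (rule ccontr)
      assume "\<not> ?thesis"
      then obtain c where "awalk_cost (\<lambda>_. 1) c < 0"
        using walk_cheaper_path_imp_neg_cyc[OF walk, of "\<lambda>_. 1"] unfolding cost
        by (auto simp: not_le)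
      then show False by (simp add: cost)
    qed
    then show "(INF p\<in>{p. apath u p v}. ereal (real (length p))) \<le> graph_dist G u v"
      unfolding graph_dist_def \<mu>_def cost by (auto intro: INF_greatest)
  qed
qed

definition proper_vertex_coloring :: "('a, 'b) pre_digraph \<Rightarrow> nat \<Rightarrow> ('a \<Rightarrow> nat) \<Rightarrow> bool" where
  "proper_vertex_coloring G k f \<longleftrightarrow>
     (\<forall>v\<in>verts G. f v \<in> {1..k}) \<and> (\<forall>u v. u \<rightarrow>\<^bsub>G\<^esub> v \<longrightarrow> f u \<noteq> f v)"

end

theory Submission
  imports Defs
begin

text \<open>
  Let \<open>n\<close> be the maximum degree. Color \<open>P\<close> first, each vertex with an allowed color. What remains is a
  list coloring problem on the other vertices in which every vertex has at least as many colors left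
  as uncolored neighbors. Such a problem can fail only in a rigid way
  (lemma \<open>blocked_leaf_block\<close>): there is an end block of an uncolored component whose
  non-cut vertices all have one and the same list, and the block is a clique. By degrees this is a
  \<open>K\<^sub>n\<close> all of whose vertices, except possibly the cut vertex, have a neighbor in \<open>P\<close>, and all these
  neighbors have the same color. So it suffices to color \<open>P\<close> without creating such a block.

  One configuration cannot be avoided by choosing colors on \<open>P\<close>: an end block \<open>D \<union> {x}\<close> in which all of
  \<open>D\<close> is adjacent to a single \<open>v \<in> P\<close>. Then \<open>D \<union> {x, v}\<close> is \<open>K\<^sub>n\<^sub>+\<^sub>1\<close> without the edge \<open>vx\<close>, and in every
  coloring with \<open>n\<close> colors \<open>x\<close> receives the color of \<open>v\<close>. Conversely, \<open>D\<close> can be colored last as soon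
  as \<open>v\<close> and \<open>x\<close> agree. All these configurations are therefore contracted at once: \<open>D\<close> and \<open>v\<close> are
  deleted, and \<open>x\<close>, called the twin of \<open>v\<close>, inherits the list of \<open>v\<close> and its remaining neighbor. The
  vertices \<open>v\<close> and \<open>x\<close> have at most one neighbor each outside \<open>D\<close>, so a twin has degree at most 2,
  which is at most the size of its list, and the degree condition survives the contraction.

  If the vertices of \<open>P\<close> are at distance at least 4, then all neighbors in \<open>P\<close> of a clique coincide, so
  a \<open>K\<^sub>n\<close> block as above would have been contracted; a bad end block made of twins is excluded because a
  twin has at most one neighbor that is a twin, and because two vertices of \<open>P\<close> have no common
  neighbor. Hence every choice of colors on \<open>P\<close> works
  (\<open>far_coloring\<close>).

  If the vertices of \<open>P\<close> are at distance at least 3 and have three colors each, then a component with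
  a twin is harmless, because the twin has more colors than neighbors. Every other dangerous component
  sends at least \<open>n\<close> edges to \<open>P\<close> from its end blocks, while a vertex of \<open>P\<close> receives at most \<open>n\<close> edges. By
  Hall's theorem the dangerous components \<open>H\<close> have distinct representatives \<open>\<phi> H \<in> P\<close>, and each has a
  second vertex \<open>\<psi> H \<in> P\<close> attached to the same end block. The graph with the edges \<open>{\<phi> H, \<psi> H}\<close> has at
  most one edge leaving each vertex, hence is 2-degenerate and can be colored from lists of size 3, and
  such a coloring of \<open>P\<close> spoils every dangerous component (\<open>three_colors_coloring\<close>).
\<close>

section \<open>Greedy list coloring\<close>

locale adjacency =
  fixes E :: "'a \<Rightarrow> 'a \<Rightarrow> bool"  (infix "\<sim>" 50)
  assumes adj_sym: "u \<sim> v \<Longrightarrow> v \<sim> u"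
    and adj_irrefl: "\<not> v \<sim> v"
begin

definition nbrs :: "'a set \<Rightarrow> 'a \<Rightarrow> 'a set" where
  "nbrs W v = {u \<in> W. v \<sim> u}"

definition list_coloring :: "'a set \<Rightarrow> ('a \<Rightarrow> 'c set) \<Rightarrow> ('a \<Rightarrow> 'c) \<Rightarrow> bool" where
  "list_coloring W L f \<longleftrightarrow> (\<forall>v\<in>W. f v \<in> L v) \<and> (\<forall>u\<in>W. \<forall>v\<in>W. u \<sim> v \<longrightarrow> f u \<noteq> f v)"

text \<open>Connectedness is expressed by cuts: \<open>closed_in W S\<close> says that no edge of \<open>W\<close> leaves \<open>S\<close>, and a set is
connected if it has no closed proper nonempty subset. In this form connectedness is used directly: a
proper subset is left by an edge, so one of its vertices has fewer neighbors in the subset than in \<open>W\<close>.\<close>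

definition closed_in :: "'a set \<Rightarrow> 'a set \<Rightarrow> bool" where
  "closed_in W S \<longleftrightarrow> S \<subseteq> W \<and> (\<forall>a\<in>S. \<forall>b\<in>W. a \<sim> b \<longrightarrow> b \<in> S)"

definition conn :: "'a set \<Rightarrow> bool" where
  "conn W \<longleftrightarrow> (\<forall>S. closed_in W S \<longrightarrow> S \<noteq> {} \<longrightarrow> S = W)"

definition clique :: "'a set \<Rightarrow> bool" where
  "clique W \<longleftrightarrow> (\<forall>u\<in>W. \<forall>v\<in>W. u \<noteq> v \<longrightarrow> u \<sim> v)"

text \<open>The critical connected instances of list coloring: every vertex has at least as many colors as neighbors, and
still there is no coloring.\<close>

definition blocked :: "'a set \<Rightarrow> ('a \<Rightarrow> 'c set) \<Rightarrow> bool" where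
  "blocked W L \<longleftrightarrow> finite W \<and> W \<noteq> {} \<and> conn W \<and> (\<forall>v\<in>W. finite (L v)) \<and>
     (\<forall>v\<in>W. card (nbrs W v) \<le> card (L v)) \<and> (\<nexists>f. list_coloring W L f)"

lemma cliqueD: "clique W \<Longrightarrow> u \<in> W \<Longrightarrow> v \<in> W \<Longrightarrow> u \<noteq> v \<Longrightarrow> u \<sim> v"
  unfolding clique_def by blast

lemma closed_in_diff: "closed_in W S \<Longrightarrow> closed_in W (W - S)"
  unfolding closed_in_def using adj_sym by blast

lemma finite_nbrs [simp]: "finite W \<Longrightarrow> finite (nbrs W v)"
  by (simp add: nbrs_def)

lemma nbrs_mono: "S \<subseteq> W \<Longrightarrow> nbrs S v \<subseteq> nbrs W v"
  by (auto simp: nbrs_def)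

lemma card_nbrs_split:
  assumes "finite W" "A \<subseteq> W"
  shows "card (nbrs W v) = card (nbrs (W - A) v) + card (nbrs A v)"
proof -
  have "nbrs W v = nbrs (W - A) v \<union> nbrs A v" "nbrs (W - A) v \<inter> nbrs A v = {}"
    using assms(2) by (auto simp: nbrs_def)
  then show ?thesis using assms by (metis card_Un_disjoint finite_Diff finite_nbrs finite_subset)
qed

lemma list_coloring_insert:
  assumes "list_coloring (W - {v}) L f" "v \<in> W" "c \<in> L v" "c \<notin> f ` nbrs (W - {v}) v"
  shows "list_coloring W L (f(v := c))"
proof -
  have "f u \<noteq> c" if "u \<in> W" "u \<sim> v \<or> v \<sim> u" for u
  proof -
    have "v \<sim> u" using that adj_sym by blast
    moreover have "u \<noteq> v" using that adj_irrefl by blast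
    ultimately have "u \<in> nbrs (W - {v}) v" using that by (simp add: nbrs_def)
    then show ?thesis using assms(4) by blast
  qed
  then show ?thesis using assms(1-3) adj_irrefl unfolding list_coloring_def
    by auto
qed

text \<open>Remove a vertex that has more colors than neighbors, color the rest, and put the vertex back.\<close>

lemma degenerate_coloring:
  assumes "finite W"
    and "\<And>S. S \<subseteq> W \<Longrightarrow> S \<noteq> {} \<Longrightarrow> \<exists>s\<in>S. card (nbrs S s) < card (L s)"
  shows "\<exists>f. list_coloring W L f"
  using assms
proof (induction "card W" arbitrary: W)
  case 0
  then show ?case by (auto simp: list_coloring_def)
next
  case (Suc m)
  then obtain s where s: "s \<in> W" "card (nbrs W s) < card (L s)"
    by (metis card.empty nat.distinct(1) order_refl)
  obtain f where f: "list_coloring (W - {s}) L f"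
    using Suc.hyps(1)[of "W - {s}"] Suc.hyps(2) Suc.prems s(1)
    by (metis Diff_subset card_Diff_singleton diff_Suc_1 finite_Diff subset_trans)
  have "card (f ` nbrs (W - {s}) s) \<le> card (nbrs (W - {s}) s)"
    using Suc.prems(1) by (simp add: card_image_le)
  also have "\<dots> \<le> card (nbrs W s)"
    using Suc.prems(1) by (intro card_mono nbrs_mono) auto
  finally have "\<not> L s \<subseteq> f ` nbrs (W - {s}) s"
    using s(2) Suc.prems(1)
    by (metis card_mono finite_Diff finite_imageI finite_nbrs le_trans linorder_not_less)
  then show ?case using list_coloring_insert[OF f s(1)] by blast
qed

lemma conn_exit:
  assumes "conn W" "S \<subseteq> W" "S \<noteq> {}" "S \<noteq> W"
  obtains a b where "a \<in> S" "b \<in> W - S" "a \<sim> b"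
  using assms unfolding conn_def closed_in_def by blast

lemma conn_exit_card:
  assumes "conn W" "finite W" "S \<subseteq> W" "S \<noteq> {}" "S \<noteq> W"
  obtains a where "a \<in> S" "card (nbrs S a) < card (nbrs W a)"
proof -
  obtain a b where ab: "a \<in> S" "b \<in> W - S" "a \<sim> b" using conn_exit assms by metis
  then have "nbrs S a \<subset> nbrs W a" using assms(3) by (auto simp: nbrs_def)
  then show ?thesis using that ab(1) assms(2) by (meson finite_nbrs psubset_card_mono)
qed

text \<open>A proper nonempty subset of a connected set contains a vertex that loses a neighbor, so only the whole
set needs the vertex \<open>w\<close>: the degeneracy condition holds for all subsets.\<close>

lemma surplus_coloring:
  assumes "conn W" "finite W" "\<And>v. v \<in> W \<Longrightarrow> card (nbrs W v) \<le> card (L v)"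
    and "w \<in> W" "card (nbrs W w) < card (L w)"
  shows "\<exists>f. list_coloring W L f"
proof (rule degenerate_coloring[OF assms(2)])
  fix S assume S: "S \<subseteq> W" "S \<noteq> {}"
  show "\<exists>s\<in>S. card (nbrs S s) < card (L s)"
  proof (cases "S = W")
    case True
    then show ?thesis using assms by blast
  next
    case False
    then obtain a where "a \<in> S" "card (nbrs S a) < card (nbrs W a)"
      using conn_exit_card[OF assms(1,2) S] by blast
    then show ?thesis using assms(3)[of a] S by force
  qed
qed

lemma blocked_tight: "blocked W L \<Longrightarrow> v \<in> W \<Longrightarrow> card (nbrs W v) = card (L v)"
  unfolding blocked_def using surplus_coloring[of W L v] by (metis le_neq_implies_less)

text \<open>Give one color \<open>c\<close> to an independent set \<open>A\<close> and delete \<open>c\<close> from the lists of the neighbors. A vertex with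
neighbors in \<open>A\<close> loses at most one color and at least one neighbor; \<open>w\<close> loses strictly more neighbors
than colors, and its surplus suffices if the rest is connected. With \<open>A\<close> a single vertex this compares
lists of neighbors; with \<open>A\<close> a pair it is the step of Lovasz's proof of Brooks' theorem.\<close>

lemma precolor_coloring:
  assumes "finite W" "conn (W - A)" "\<And>v. v \<in> W \<Longrightarrow> card (nbrs W v) \<le> card (L v)"
    and fin: "\<And>v. v \<in> W \<Longrightarrow> finite (L v)"
    and A: "A \<subseteq> W" "\<And>a. a \<in> A \<Longrightarrow> c \<in> L a" "\<And>a b. a \<in> A \<Longrightarrow> b \<in> A \<Longrightarrow> \<not> a \<sim> b"
    and w: "w \<in> W - A" "c \<notin> L w \<and> nbrs A w \<noteq> {} \<or> card (nbrs A w) \<ge> 2"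
  shows "\<exists>f. list_coloring W L f"
proof -
  define L' where "L' v = (if nbrs A v = {} then L v else L v - {c})" for v
  have split: "card (nbrs W v) = card (nbrs (W - A) v) + card (nbrs A v)" for v
    using card_nbrs_split[OF assms(1) A(1)] .
  have fA: "finite (nbrs A v)" for v using assms(1) A(1) by (meson finite_nbrs finite_subset)
  have le: "card (nbrs (W - A) v) \<le> card (L' v)" if "v \<in> W" for v
  proof (cases "nbrs A v = {}")
    case True
    then show ?thesis using assms(3)[OF that] split[of v] by (simp add: L'_def)
  next
    case False
    then have "card (nbrs A v) \<ge> 1" using fA by (simp add: Suc_le_eq card_gt_0_iff)
    moreover have "card (L v) \<le> Suc (card (L v - {c}))"
      using fin[OF that] by (cases "c \<in> L v") (simp_all add: card_Suc_Diff1)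
    ultimately show ?thesis using assms(3)[OF that] split[of v] False by (simp add: L'_def)
  qed
  \<comment> \<open>The surplus of \<open>w\<close>: it keeps all its colors, or it loses two neighbors but only one color.\<close>
  have "card (nbrs (W - A) w) < card (L' w)"
    using w(2)
  proof
    assume "c \<notin> L w \<and> nbrs A w \<noteq> {}"
    moreover from this have "card (nbrs A w) \<ge> 1" using fA by (simp add: Suc_le_eq card_gt_0_iff)
    ultimately show ?thesis using assms(3)[of w] split[of w] w(1) by (simp add: L'_def)
  next
    assume *: "card (nbrs A w) \<ge> 2"
    then have "nbrs A w \<noteq> {}" by force
    moreover have "card (L w) \<le> Suc (card (L w - {c}))"
      using fin[of w] w(1) by (cases "c \<in> L w") (simp_all add: card_Suc_Diff1)
    ultimately show ?thesis using assms(3)[of w] split[of w] w(1) * by (simp add: L'_def)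
  qed
  then obtain f where f: "list_coloring (W - A) L' f"
    using surplus_coloring[of "W - A" L' w] assms(1,2) le w(1) by auto
  have avoid: "f v \<noteq> c" if "v \<in> W - A" "a \<in> A" "v \<sim> a" for v a
  proof -
    have "nbrs A v \<noteq> {}" using that by (auto simp: nbrs_def)
    then have "L' v = L v - {c}" by (simp add: L'_def)
    then show ?thesis using f that(1) unfolding list_coloring_def by blast
  qed
  have "L' v \<subseteq> L v" for v by (simp add: L'_def)
  then have fL: "f v \<in> L v" if "v \<in> W - A" for v
    using f that unfolding list_coloring_def by blast
  have fE: "f u \<noteq> f v" if "u \<in> W - A" "v \<in> W - A" "u \<sim> v" for u v
    using f that unfolding list_coloring_def by blast
  have "list_coloring W L (\<lambda>v. if v \<in> A then c else f v)"
    unfolding list_coloring_def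
  proof (intro conjI ballI impI)
    fix v assume "v \<in> W"
    then show "(if v \<in> A then c else f v) \<in> L v" using fL A(2) by simp
  next
    fix u v assume "u \<in> W" "v \<in> W" "u \<sim> v"
    then show "(if u \<in> A then c else f u) \<noteq> (if v \<in> A then c else f v)"
      using fE[of u v] A(3)[of u v] avoid[of u v] avoid[of v u] adj_sym[of u v] by auto
  qed
  then show ?thesis by blast
qed

lemma blocked_list_subset:
  assumes "blocked W L" "v \<in> W" "conn (W - {v})" "u \<in> W" "v \<sim> u"
  shows "L v \<subseteq> L u"
proof (rule ccontr)
  assume "\<not> ?thesis"
  then obtain c where c: "c \<in> L v" "c \<notin> L u" by blast
  have "nbrs {v} u \<noteq> {}" "u \<noteq> v" using assms(5) adj_sym adj_irrefl by (auto simp: nbrs_def)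
  then show False
    using precolor_coloring[of W "{v}" L c u] assms c adj_irrefl by (auto simp: blocked_def)
qed

section \<open>End blocks\<close>

text \<open>\<open>sep W D x\<close> says that only \<open>x\<close> separates \<open>D\<close> from the rest of \<open>W\<close>; a minimal such \<open>D\<close> consists of the non-cut
vertices of an end block with cut vertex \<open>x\<close>. The vertex \<open>x\<close> may lie outside \<open>W\<close>, and then \<open>D\<close> is
closed in \<open>W\<close>. If \<open>W\<close> is connected, has at least two vertices and no cut vertex, then \<open>D\<close> is \<open>W\<close> without an
arbitrary vertex.\<close>

definition sep :: "'a set \<Rightarrow> 'a set \<Rightarrow> 'a \<Rightarrow> bool" where
  "sep W D x \<longleftrightarrow> D \<noteq> {} \<and> D \<subseteq> W \<and> x \<notin> D \<and> (\<forall>d\<in>D. nbrs W d \<subseteq> insert x D)"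

definition leaf :: "'a set \<Rightarrow> 'a set \<Rightarrow> 'a \<Rightarrow> bool" where
  "leaf W D x \<longleftrightarrow> sep W D x \<and> (\<forall>D' x'. D' \<subseteq> D \<longrightarrow> sep W D' x' \<longrightarrow> D' = D)"

lemma leaf_exists:
  assumes "finite W" "sep W D x"
  obtains D' x' where "D' \<subseteq> D" "leaf W D' x'"
proof -
  define M where "M = {D'. D' \<subseteq> D \<and> (\<exists>x'. sep W D' x')}"
  have "finite D" using assms by (meson finite_subset sep_def)
  then have "finite M" by (simp add: M_def)
  moreover have "D \<in> M" using assms(2) by (auto simp: M_def)
  ultimately obtain D' where "D' \<in> M" and min: "\<And>D''. D'' \<in> M \<Longrightarrow> D'' \<subseteq> D' \<Longrightarrow> D'' = D'"
    using finite_has_minimal[of M] by (metis empty_iff)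
  then obtain x' where "D' \<subseteq> D" "sep W D' x'" by (auto simp: M_def)
  moreover have "D'' = D'" if "D'' \<subseteq> D'" "sep W D'' x''" for D'' x''
    using min[of D''] that \<open>D' \<subseteq> D\<close> by (auto simp: M_def)
  ultimately show ?thesis using that unfolding leaf_def by blast
qed

text \<open>If deleting \<open>a\<close> disconnected \<open>W\<close>, then a side that avoids \<open>x\<close> would either meet \<open>D\<close> in a smaller set,
separated by \<open>a\<close>, or be disjoint from \<open>D\<close> and closed in \<open>W\<close>.\<close>

lemma leaf_remove_conn:
  assumes "conn W" "leaf W D x" "a \<in> D"
  shows "conn (W - {a})"
  unfolding conn_def
proof (intro allI impI)
  fix S assume S: "closed_in (W - {a}) S" "S \<noteq> {}"
  have D: "D \<subseteq> W" "x \<notin> D" "\<And>d u. d \<in> D \<Longrightarrow> u \<in> W \<Longrightarrow> d \<sim> u \<Longrightarrow> u = x \<or> u \<in> D"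
    using assms(2) by (auto simp: leaf_def sep_def nbrs_def)
  have *: "T = {}" if T: "closed_in (W - {a}) T" "x \<notin> T" for T
  proof -
    have "T \<inter> D = {}"
    proof (rule ccontr)
      assume ne: "T \<inter> D \<noteq> {}"
      have "sep W (T \<inter> D) a"
        using T D ne unfolding sep_def closed_in_def nbrs_def by blast
      then have "T \<inter> D = D" using assms(2) unfolding leaf_def by blast
      then show False using assms(3) T(1) unfolding closed_in_def by blast
    qed
    then have "closed_in W T"
      using T D assms(3) adj_sym unfolding closed_in_def by blast
    then show "T = {}"
      using assms(1,3) T(1) D(1) unfolding conn_def closed_in_def by (metis Diff_iff in_mono singletonI)
  qed
  have "closed_in (W - {a}) (W - {a} - S)" using S(1) closed_in_diff by blast
  then show "S = W - {a}"
    using *[of S] *[of "W - {a} - S"] S unfolding closed_in_def by blast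
qed

text \<open>Deleting a cut vertex leaves two sides without edges between them, and each side contains an end block.\<close>

lemma two_leaves:
  assumes "finite W" "\<not> conn (W - {z})"
  obtains D1 x1 D2 x2 where "leaf W D1 x1" "leaf W D2 x2" "D1 \<inter> D2 = {}"
    "\<And>a b. a \<in> D1 \<Longrightarrow> b \<in> D2 \<Longrightarrow> \<not> a \<sim> b"
proof -
  obtain S where S: "closed_in (W - {z}) S" "S \<noteq> {}" "S \<noteq> W - {z}"
    using assms(2) unfolding conn_def by blast
  define T where "T = W - {z} - S"
  have T: "closed_in (W - {z}) T" "T \<noteq> {}"
    using closed_in_diff[OF S(1)] S unfolding T_def closed_in_def by blast+
  have sepI: "sep W U z" if "closed_in (W - {z}) U" "U \<noteq> {}" for U
    using that unfolding sep_def closed_in_def nbrs_def by blast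
  have "sep W S z" "sep W T z" using sepI S T by simp_all
  then obtain D1 x1 D2 x2 where "D1 \<subseteq> S" "leaf W D1 x1" "D2 \<subseteq> T" "leaf W D2 x2"
    using leaf_exists[OF assms(1), of S z] leaf_exists[OF assms(1), of T z] by metis
  moreover have "\<not> a \<sim> b" if "a \<in> S" "b \<in> T" for a b
    using that S(1) T(1) unfolding closed_in_def T_def by blast
  moreover have "S \<inter> T = {}" by (auto simp: T_def)
  ultimately show ?thesis using that by blast
qed

lemma leaf_remove_two_conn:
  assumes "conn W" "leaf W D1 x1" "leaf W D2 x2" "D1 \<inter> D2 = {}"
    "\<And>a b. a \<in> D1 \<Longrightarrow> b \<in> D2 \<Longrightarrow> \<not> a \<sim> b" "a \<in> D1" "b \<in> D2"
  shows "conn (W - {a, b})"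
proof -
  have na: "\<not> d \<sim> a" if "d \<in> D2" for d using assms(5,6) that adj_sym by blast
  have "nbrs (W - {a}) d = nbrs W d" if "d \<in> D2" for d
    using na[OF that] by (auto simp: nbrs_def)
  moreover have "D2 \<subseteq> W \<longleftrightarrow> D2 \<subseteq> W - {a}" using assms(4,6) by blast
  ultimately have "sep (W - {a}) D' x' \<longleftrightarrow> sep W D' x'" if "D' \<subseteq> D2" for D' x'
    using that assms(4,6) unfolding sep_def by (metis Diff_empty IntI disjoint_iff subset_Diff_insert subset_iff)
  then have "leaf (W - {a}) D2 x2" using assms(3) unfolding leaf_def by blast
  then have "conn (W - {a} - {b})"
    using leaf_remove_conn[of "W - {a}"] leaf_remove_conn[OF assms(1,2,6)] assms(7) by blast
  then show ?thesis by (metis Diff_insert2 insert_commute)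
qed

section \<open>Brooks' theorem for uncolorable blocks\<close>

lemma conn_insert:
  assumes "conn U" "u \<in> U" "y \<sim> u"
  shows "conn (insert y U)"
  unfolding conn_def
proof (intro allI impI)
  fix S assume S: "closed_in (insert y U) S" "S \<noteq> {}"
  have "closed_in U (S \<inter> U)" using S(1) unfolding closed_in_def by blast
  moreover have "S \<inter> U \<noteq> {}"
    using S assms(2,3) unfolding closed_in_def by blast
  ultimately have "S \<inter> U = U" using assms(1) unfolding conn_def by blast
  then have "u \<in> S" using assms(2) by blast
  then have "y \<in> S" using S(1) adj_sym[OF assms(3)] unfolding closed_in_def by blast
  then show "S = insert y U" using S(1) \<open>S \<inter> U = U\<close> unfolding closed_in_def by blast
qed

lemma induced_path_exists:
  assumes "conn W" "\<not> clique W"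
  obtains a y b where "a \<in> W" "y \<in> W" "b \<in> W" "y \<sim> a" "y \<sim> b" "a \<noteq> b" "\<not> a \<sim> b"
proof -
  obtain v w where vw: "v \<in> W" "w \<in> W" "v \<noteq> w" "\<not> v \<sim> w" using assms(2) by (auto simp: clique_def)
  define S where "S = insert v (nbrs W v)"
  have S: "S \<subseteq> W" "S \<noteq> {}" "w \<notin> S" using vw by (auto simp: S_def nbrs_def)
  then have "S \<noteq> W" using vw(2) by blast
  then obtain y b where yb: "y \<in> S" "b \<in> W - S" "y \<sim> b" using conn_exit[OF assms(1) S(1,2)] by blast
  then have "y \<noteq> v" "v \<noteq> b" "\<not> v \<sim> b" by (auto simp: S_def nbrs_def)
  then have "y \<sim> v" using yb(1) adj_sym by (auto simp: S_def nbrs_def)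
  then show ?thesis using that[of v y b] \<open>v \<noteq> b\<close> \<open>\<not> v \<sim> b\<close> vw(1) yb S(1) by blast
qed

text \<open>If \<open>W\<close> has no cut vertex, a deleted vertex \<open>y\<close> has neighbors inside every end block of the rest:
otherwise \<open>x\<close> alone would already cut off \<open>D\<close> in \<open>W\<close>.\<close>

lemma touches_sep:
  assumes "conn W" "\<And>v. v \<in> W \<Longrightarrow> conn (W - {v})" "y \<in> W"
    and D: "sep (W - {y}) D x" and T: "T \<noteq> {}" "T \<subseteq> W - {y} - D"
  shows "\<exists>a\<in>D. y \<sim> a"
proof (rule ccontr)
  assume *: "\<not> ?thesis"
  have nb: "b \<in> insert x D" if "d \<in> D" "b \<in> W" "d \<sim> b" for d b
  proof -
    have "b \<noteq> y" using * that adj_sym by blast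
    then show ?thesis using that D unfolding sep_def nbrs_def by blast
  qed
  have Dsub: "D \<noteq> {}" "D \<subseteq> W - {y}" "x \<notin> D" using D by (auto simp: sep_def)
  show False
  proof (cases "x \<in> W")
    case True
    have "closed_in (W - {x}) D" using nb Dsub unfolding closed_in_def by blast
    then have "D = W - {x}" using assms(2)[OF True] Dsub unfolding conn_def by blast
    then show False using T Dsub assms(3) by blast
  next
    case False
    have "closed_in W D" using nb Dsub False unfolding closed_in_def by blast
    then have "D = W" using assms(1) Dsub unfolding conn_def by blast
    then show False using Dsub assms(3) by blast
  qed
qed

text \<open>The pair in Lovasz's proof of Brooks' theorem. If the ends \<open>p, r\<close> of an induced path do not do, then
\<open>r\<close> is a cut vertex of \<open>W - {p}\<close>, and \<open>p\<close> has neighbors \<open>a, b\<close> in two different end blocks of \<open>W - {p}\<close>.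
Deleting \<open>a\<close> and \<open>b\<close> does not disconnect \<open>W - {p}\<close>, and \<open>p\<close> has a third neighbor that attaches it to the rest.\<close>

lemma lovasz_pair:
  assumes fin: "finite W" and W: "conn W" "\<And>v. v \<in> W \<Longrightarrow> conn (W - {v})"
    and deg: "\<And>v. v \<in> W \<Longrightarrow> card (nbrs W v) \<ge> 3" and "\<not> clique W"
  obtains a y b where "a \<in> W" "y \<in> W" "b \<in> W" "y \<sim> a" "y \<sim> b" "a \<noteq> b" "\<not> a \<sim> b"
    "conn (W - {a, b})"
proof -
  obtain p q r where pqr: "p \<in> W" "q \<in> W" "r \<in> W" "q \<sim> p" "q \<sim> r" "p \<noteq> r" "\<not> p \<sim> r"
    using induced_path_exists[OF W(1) assms(5)] by blast
  show ?thesis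
  proof (cases "conn (W - {p, r})")
    case True
    then show ?thesis using pqr that by blast
  next
    case False
    then have "\<not> conn (W - {p} - {r})" by (metis Diff_insert2)
    then obtain D1 x1 D2 x2 where D: "leaf (W - {p}) D1 x1" "leaf (W - {p}) D2 x2" "D1 \<inter> D2 = {}"
      "\<And>a b. a \<in> D1 \<Longrightarrow> b \<in> D2 \<Longrightarrow> \<not> a \<sim> b"
      using two_leaves[of "W - {p}" r] fin by (metis finite_Diff)
    have s: "sep (W - {p}) D1 x1" "sep (W - {p}) D2 x2" using D by (auto simp: leaf_def)
    then have sub: "D1 \<noteq> {}" "D2 \<noteq> {}" "D1 \<subseteq> W - {p}" "D2 \<subseteq> W - {p}" by (auto simp: sep_def)
    obtain a where a: "a \<in> D1" "p \<sim> a"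
      using touches_sep[OF W pqr(1) s(1), of D2] sub D(3) by blast
    obtain b where b: "b \<in> D2" "p \<sim> b"
      using touches_sep[OF W pqr(1) s(2), of D1] sub D(3) by blast
    have c: "conn (W - {p} - {a, b})"
      using leaf_remove_two_conn[OF W(2)[OF pqr(1)] D a(1) b(1)] .
    have "card (nbrs W p - {a, b}) > 0"
      using deg[OF pqr(1)] diff_card_le_card_Diff[of "{a, b}" "nbrs W p"] card_insert_le_m1[of 2 "{b}" a]
      by simp
    then obtain u where "u \<in> nbrs W p - {a, b}" by (metis card_gt_0_iff equals0I)
    then have "u \<in> W - {p} - {a, b}" "p \<sim> u" using adj_irrefl by (auto simp: nbrs_def)
    then have "conn (insert p (W - {p} - {a, b}))" using conn_insert[OF c] by blast
    moreover have "insert p (W - {p} - {a, b}) = W - {a, b}" using sub a b pqr(1) by blast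
    ultimately show ?thesis
      using that[of a p b] a b sub pqr(1) D(3,4) by auto
  qed
qed

text \<open>Brooks' theorem: if the graph is not complete, give a common color to the pair of Lovasz; their
common neighbor then has a surplus.\<close>

lemma blocked_constant_clique:
  assumes W: "blocked W L" "\<And>v. v \<in> W \<Longrightarrow> conn (W - {v})"
    and L: "\<And>v. v \<in> W \<Longrightarrow> L v = C" and "card C \<ge> 3"
  shows "clique W"
proof (rule ccontr)
  assume nc: "\<not> clique W"
  have "card (nbrs W v) \<ge> 3" if "v \<in> W" for v
    using blocked_tight[OF W(1) that] L[OF that] assms(4) by simp
  then obtain a y b where ab: "a \<in> W" "y \<in> W" "b \<in> W" "y \<sim> a" "y \<sim> b" "a \<noteq> b" "\<not> a \<sim> b"
    "conn (W - {a, b})"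
    using lovasz_pair[of W] W nc unfolding blocked_def by metis
  obtain c where "c \<in> C" using assms(4) by fastforce
  have "nbrs {a, b} y = {a, b}" using ab by (auto simp: nbrs_def)
  then have "card (nbrs {a, b} y) \<ge> 2" using ab(6) by simp
  moreover have "\<not> b \<sim> a" using ab(7) adj_sym by blast
  moreover have "y \<noteq> a" "y \<noteq> b" using ab adj_irrefl by blast+
  ultimately have "\<exists>f. list_coloring W L f"
    using precolor_coloring[of W "{a, b}" L c y] W(1) ab L \<open>c \<in> C\<close> adj_irrefl
    unfolding blocked_def by auto
  then show False using W(1) by (auto simp: blocked_def)
qed

text \<open>Without cut vertices, adjacent vertices have lists contained in each other.\<close>

lemma blocked_constant:
  assumes W: "blocked W L" "\<And>v. v \<in> W \<Longrightarrow> conn (W - {v})"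
  obtains C where "\<And>v. v \<in> W \<Longrightarrow> L v = C"
proof -
  obtain v0 where v0: "v0 \<in> W" using W(1) by (auto simp: blocked_def)
  have "L a = L b" if "a \<in> W" "b \<in> W" "a \<sim> b" for a b
    using blocked_list_subset[OF W(1), of a b] blocked_list_subset[OF W(1), of b a]
      W(2) adj_sym that by blast
  then have "closed_in W {v \<in> W. L v = L v0}"
    unfolding closed_in_def by blast
  then have "{v \<in> W. L v = L v0} = W"
    using W(1) v0 unfolding blocked_def conn_def by blast
  then show ?thesis using that[of "L v0"] by blast
qed

text \<open>An end block together with its cut vertex has no cut vertex of its own, by minimality.\<close>

lemma leaf_block_conn:
  assumes "conn W" "leaf W D x"
  defines "B \<equiv> W \<inter> insert x D"
  shows "conn B" and "\<And>b. b \<in> B \<Longrightarrow> conn (B - {b})"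
proof -
  have D: "D \<noteq> {}" "D \<subseteq> W" "x \<notin> D" "\<And>d. d \<in> D \<Longrightarrow> nbrs W d \<subseteq> insert x D"
    using assms(2) by (auto simp: leaf_def sep_def)
  have cD: "conn D"
    unfolding conn_def
  proof (intro allI impI)
    fix S assume S: "closed_in D S" "S \<noteq> {}"
    have "sep W S x" using S D unfolding sep_def closed_in_def nbrs_def by blast
    then show "S = D" using assms(2) S unfolding leaf_def closed_in_def by blast
  qed
  have touch: "\<exists>d\<in>D. x \<sim> d" if "x \<in> W"
  proof (rule ccontr)
    assume *: "\<not> ?thesis"
    then have "closed_in W D" using D adj_sym unfolding closed_in_def nbrs_def by blast
    then have "D = W" using D(1) assms(1) unfolding conn_def by blast
    then show False using that D(3) by blast
  qed
  show cB: "conn B"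
  proof (cases "x \<in> W")
    case True
    then have "B = insert x D" using D by (auto simp: B_def)
    then show ?thesis using touch[OF True] conn_insert[OF cD] by auto
  next
    case False
    then have "B = D" using D by (auto simp: B_def)
    then show ?thesis using cD by simp
  qed
  have sepB: "sep B D' x' \<longleftrightarrow> sep W D' x'" if "D' \<subseteq> D" for D' x'
  proof -
    have "nbrs B d = nbrs W d" if "d \<in> D" for d
      using D(4)[OF that] by (auto simp: nbrs_def B_def)
    moreover have "D \<subseteq> B" using D(2) by (auto simp: B_def)
    ultimately show ?thesis using that D(2) unfolding sep_def by (metis subset_iff)
  qed
  then have "leaf B D x" using assms(2) unfolding leaf_def by blast
  fix b assume "b \<in> B"
  show "conn (B - {b})"
  proof (cases "b = x")
    case True
    then have "B - {b} = D" using D by (auto simp: B_def)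
    then show ?thesis using cD by simp
  next
    case False
    then have "b \<in> D" using \<open>b \<in> B\<close> by (auto simp: B_def)
    then show ?thesis using leaf_remove_conn[OF cB \<open>leaf B D x\<close>] by blast
  qed
qed

text \<open>A part of the theorem of Erdos, Rubin and Taylor on degree-choosable graphs. The
vertices outside the end block \<open>B\<close> can be colored greedily, since every set of them is left by an edge. There remains a
blocked instance on \<open>B\<close>, where only \<open>x\<close> has lost colors. As \<open>B\<close> has no cut vertex, all its
remaining lists agree, and Brooks' theorem applies.\<close>

lemma blocked_leaf_block:
  assumes W: "blocked W L" and leaf: "leaf W D x"
  defines "B \<equiv> W \<inter> insert x D"
  obtains C where "\<And>d. d \<in> D \<Longrightarrow> L d = C" "\<And>b. b \<in> B \<Longrightarrow> card (nbrs B b) = card C"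
    "3 \<le> card C \<Longrightarrow> clique B" "C \<noteq> {} \<Longrightarrow> x \<in> W"
proof -
  have fin: "finite W" "conn W" "\<And>v. v \<in> W \<Longrightarrow> finite (L v)" using W by (auto simp: blocked_def)
  have D: "D \<noteq> {}" "D \<subseteq> W" "x \<notin> D" "\<And>d. d \<in> D \<Longrightarrow> nbrs W d \<subseteq> insert x D"
    using leaf by (auto simp: leaf_def sep_def)
  have BW: "B \<subseteq> W" "D \<subseteq> B" using D(2) by (auto simp: B_def)
  have "\<exists>g. list_coloring (W - B) L g"
  proof (rule degenerate_coloring)
    show "finite (W - B)" using fin by simp
    fix S assume S: "S \<subseteq> W - B" "S \<noteq> {}"
    then have "S \<subseteq> W" "S \<noteq> W" using D(1) BW by blast+
    then obtain a where "a \<in> S" "card (nbrs S a) < card (nbrs W a)"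
      using conn_exit_card[OF fin(2,1)] S(2) by blast
    then show "\<exists>s\<in>S. card (nbrs S s) < card (L s)"
      using blocked_tight[OF W] \<open>S \<subseteq> W\<close> by (metis subsetD)
  qed
  then obtain g where g: "list_coloring (W - B) L g" by blast
  \<comment> \<open>Within the end block only \<open>x\<close> has neighbors outside, so only its list is affected by \<open>g\<close>.\<close>
  define L' where "L' v = (if v = x then L x - g ` nbrs (W - B) x else L v)" for v
  have "card (nbrs B v) \<le> card (L' v)" if v: "v \<in> B" for v
  proof (cases "v = x")
    case True
    have "card (nbrs W x) = card (nbrs (W - B) x) + card (nbrs B x)"
      using card_nbrs_split[OF fin(1) BW(1)] .
    moreover have "card (g ` nbrs (W - B) x) \<le> card (nbrs (W - B) x)"
      using fin(1) by (simp add: card_image_le)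
    moreover have "card (L x) - card (g ` nbrs (W - B) x) \<le> card (L' x)"
      unfolding L'_def using fin(1) by (simp add: diff_card_le_card_Diff)
    ultimately show ?thesis using blocked_tight[OF W, of x] v BW True by auto
  next
    case False
    then show ?thesis
      using v BW blocked_tight[OF W, of v] card_mono[OF finite_nbrs[OF fin(1)] nbrs_mono[OF BW(1), of v]]
      by (auto simp: L'_def)
  qed
  moreover have "\<nexists>f. list_coloring B L' f"
  proof
    assume "\<exists>f. list_coloring B L' f"
    then obtain f where f: "list_coloring B L' f" by blast
    have mixed: "f u \<noteq> g v" if "u \<in> B" "v \<in> W - B" "u \<sim> v" for u v
    proof -
      have "u \<notin> D" using that D(4)[of u] BW by (auto simp: nbrs_def B_def)
      then have "u = x" using that(1) by (auto simp: B_def)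
      moreover have "v \<in> nbrs (W - B) u" using that by (auto simp: nbrs_def)
      ultimately show ?thesis using f that(1) unfolding list_coloring_def L'_def by auto
    qed
    have "L' v \<subseteq> L v" for v by (simp add: L'_def)
    then have fL: "f v \<in> L v" if "v \<in> B" for v using f that unfolding list_coloring_def by blast
    have "list_coloring W L (\<lambda>v. if v \<in> B then f v else g v)"
      unfolding list_coloring_def
    proof (intro conjI ballI impI)
      fix v assume "v \<in> W"
      then show "(if v \<in> B then f v else g v) \<in> L v"
        using fL g by (simp add: list_coloring_def)
    next
      fix u v assume uv: "u \<in> W" "v \<in> W" "u \<sim> v"
      have "f u \<noteq> f v" if "u \<in> B" "v \<in> B" using f that uv(3) unfolding list_coloring_def by blast
      moreover have "g u \<noteq> g v" if "u \<notin> B" "v \<notin> B"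
        using g that uv unfolding list_coloring_def by blast
      ultimately show "(if u \<in> B then f u else g u) \<noteq> (if v \<in> B then f v else g v)"
        using mixed[of u v] mixed[of v u] adj_sym[OF uv(3)] uv by auto
    qed
    then show False using W by (auto simp: blocked_def)
  qed
  moreover have "B \<noteq> {}" "finite B" using D(1) BW finite_subset[OF BW(1) fin(1)] by auto
  moreover have "finite (L' v)" if "v \<in> B" for v using fin(3) that BW(1) by (auto simp: L'_def)
  ultimately have blB: "blocked B L'"
    using leaf_block_conn(1)[OF fin(2) leaf] unfolding blocked_def B_def by blast
  have cut: "conn (B - {b})" if "b \<in> B" for b
    using leaf_block_conn(2)[OF fin(2) leaf] that unfolding B_def by blast
  obtain C where C: "\<And>v. v \<in> B \<Longrightarrow> L' v = C" using blocked_constant[OF blB cut] by blast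
  have LD: "L d = C" if "d \<in> D" for d using C[of d] that BW(2) D(3) unfolding L'_def by (metis subsetD)
  show ?thesis
  proof (rule that[of C])
    show "L d = C" if "d \<in> D" for d using LD that .
    show "card (nbrs B b) = card C" if "b \<in> B" for b using blocked_tight[OF blB that] C[OF that] by simp
    show "clique B" if "3 \<le> card C" using blocked_constant_clique[OF blB cut C that] .
    show "x \<in> W" if "C \<noteq> {}"
    proof (rule ccontr)
      assume x: "x \<notin> W"
      have "closed_in W D" using D x unfolding closed_in_def nbrs_def by blast
      then have DW: "D = W" using D(1) fin(2) unfolding conn_def by blast
      \<comment> \<open>If \<open>x\<close> lies outside \<open>W\<close>, minimality leaves only a one-point component, whose list is empty.\<close>
      obtain d where d: "d \<in> D" using D(1) by blast
      have "D - {d} = {}"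
      proof (rule ccontr)
        assume "D - {d} \<noteq> {}"
        then have "sep W (D - {d}) d" using DW unfolding sep_def nbrs_def by blast
        then show False using leaf d unfolding leaf_def by blast
      qed
      then have "nbrs W d = {}" using DW adj_irrefl by (auto simp: nbrs_def)
      then have "card (L d) = 0" using blocked_tight[OF W, of d] d D(2) by auto
      then show False using LD[OF d] that fin(3)[of d] d D(2) by auto
    qed
  qed
qed

section \<open>Uncolorable components and cliques\<close>

text \<open>A minimal closed set without a coloring is connected, because the sides of a disconnected set could be
colored independently.\<close>

lemma blocked_component:
  assumes "finite W" "\<And>v. v \<in> W \<Longrightarrow> finite (L v)"
    and "\<And>v. v \<in> W \<Longrightarrow> card (nbrs W v) \<le> card (L v)" and "\<nexists>f. list_coloring W L f"
  obtains H where "closed_in W H" "blocked H L"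
proof -
  define M where "M = {H. closed_in W H \<and> (\<nexists>f. list_coloring H L f)}"
  have "M \<subseteq> Pow W" by (auto simp: M_def closed_in_def)
  then have "finite M" using assms(1) by (meson finite_Pow_iff finite_subset)
  moreover have "W \<in> M" using assms(4) by (auto simp: M_def closed_in_def)
  ultimately obtain H where H: "H \<in> M" "\<And>S. S \<in> M \<Longrightarrow> S \<subseteq> H \<Longrightarrow> S = H"
    using finite_has_minimal[of M] by (metis empty_iff)
  have HW: "closed_in W H" "H \<subseteq> W" "\<nexists>f. list_coloring H L f" using H(1) by (auto simp: M_def closed_in_def)
  have "conn H"
    unfolding conn_def
  proof (intro allI impI, rule ccontr)
    fix S assume S: "closed_in H S" "S \<noteq> {}" "S \<noteq> H"
    have trans: "closed_in W U" if "closed_in H U" for U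
      using that HW(1) unfolding closed_in_def by blast
    have "S \<notin> M" "H - S \<notin> M" using H(2)[of S] H(2)[of "H - S"] S unfolding closed_in_def by blast+
    then obtain f g where fg: "list_coloring S L f" "list_coloring (H - S) L g"
      using trans[OF S(1)] trans[OF closed_in_diff[OF S(1)]] by (auto simp: M_def)
    have "u \<in> S \<longleftrightarrow> v \<in> S" if "u \<in> H" "v \<in> H" "u \<sim> v" for u v
      using S(1) that adj_sym unfolding closed_in_def by blast
    then have "list_coloring H L (\<lambda>v. if v \<in> S then f v else g v)"
      using fg unfolding list_coloring_def by auto
    then show False using HW(3) by blast
  qed
  moreover have "H \<noteq> {}" using HW(3) by (auto simp: list_coloring_def)
  moreover have "nbrs H v = nbrs W v" if "v \<in> H" for v
    using HW(1) that by (auto simp: closed_in_def nbrs_def)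
  moreover have "finite H" using HW(2) assms(1) finite_subset by blast
  ultimately have "blocked H L"
    using assms(2,3) HW unfolding blocked_def by auto
  then show ?thesis using that HW(1) by blast
qed

text \<open>A vertex of \<open>D'\<close> is adjacent to all of \<open>insert x D\<close>, so \<open>x'\<close> can only be \<open>x\<close>, and \<open>D'\<close> is all of \<open>D\<close>.\<close>

lemma clique_leaf:
  assumes "sep W D x" "x \<in> W" "clique (insert x D)"
  shows "leaf W D x"
  unfolding leaf_def
proof (intro conjI allI impI)
  fix D' x' assume D': "D' \<subseteq> D" "sep W D' x'"
  then obtain d where d: "d \<in> D'" by (auto simp: sep_def)
  have "insert x D - {d} \<subseteq> nbrs W d"
  proof
    fix u assume u: "u \<in> insert x D - {d}"
    then have "u \<in> W" using assms(1,2) by (auto simp: sep_def)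
    moreover have "d \<in> insert x D" "u \<in> insert x D" "d \<noteq> u" using d D'(1) u by auto
    then have "d \<sim> u" using cliqueD[OF assms(3)] by blast
    ultimately show "u \<in> nbrs W d" by (simp add: nbrs_def)
  qed
  then have "insert x D \<subseteq> insert x' D'" using D'(2) d unfolding sep_def by blast
  moreover have "x \<notin> D'" using D'(1) assms(1) by (auto simp: sep_def)
  ultimately have "x = x'" by blast
  then show "D' = D" using \<open>insert x D \<subseteq> insert x' D'\<close> assms(1) D'(1) by (auto simp: sep_def)
qed (fact assms(1))

lemma card_nbrs_clique:
  assumes "finite B" "clique B" "b \<in> B"
  shows "card (nbrs B b) = card B - 1"
proof -
  have "nbrs B b = B - {b}" using assms adj_irrefl by (auto simp: nbrs_def clique_def)
  then show ?thesis using assms by simp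
qed

end

section \<open>Distinct representatives\<close>

text \<open>The proof of Halmos and Vaughan. If some proper nonempty subfamily \<open>J\<close> has exactly as many
candidates as members, serve \<open>J\<close> first and the rest from the other candidates. Otherwise
every proper nonempty subfamily has a candidate to spare, and an arbitrary choice for one index does no harm.\<close>

theorem hall:
  assumes "finite I" "\<And>i. i \<in> I \<Longrightarrow> finite (A i)"
    and "\<And>J. J \<subseteq> I \<Longrightarrow> card J \<le> card (\<Union>i\<in>J. A i)"
  shows "\<exists>\<phi>. inj_on \<phi> I \<and> (\<forall>i\<in>I. \<phi> i \<in> A i)"
  using assms
proof (induction "card I" arbitrary: I A rule: less_induct)
  case less
  note fin = less.prems(1,2) and hc = less.prems(3)
  show ?case
  proof (cases "\<exists>J. J \<subset> I \<and> J \<noteq> {} \<and> card J = card (\<Union>i\<in>J. A i)")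
    case True
    then obtain J where J: "J \<subset> I" "J \<noteq> {}" "card J = card (\<Union>i\<in>J. A i)" by blast
    define U where "U = (\<Union>i\<in>J. A i)"
    have finJ: "finite J" "finite U" using J fin finite_subset[of J I] by (auto simp: U_def)
    have "card J < card I" using J(1) fin(1) by (simp add: psubset_card_mono)
    then obtain \<phi> where \<phi>: "inj_on \<phi> J" "\<And>i. i \<in> J \<Longrightarrow> \<phi> i \<in> A i"
      using less.hyps[of J A] fin hc J(1) finJ by (metis psubset_imp_subset subset_iff subset_trans)
    have "card K \<le> card (\<Union>i\<in>K. A i - U)" if K: "K \<subseteq> I - J" for K
    proof -
      have finK: "finite K" "finite (\<Union>i\<in>K. A i - U)" using K fin finite_subset[of K I] by auto
      have "card K + card J = card (K \<union> J)"
        using K finK(1) finJ(1) by (subst card_Un_disjoint) auto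
      also have "\<dots> \<le> card (\<Union>i\<in>K \<union> J. A i)" using hc[of "K \<union> J"] K J(1) by blast
      also have "(\<Union>i\<in>K \<union> J. A i) = (\<Union>i\<in>K. A i - U) \<union> U" by (auto simp: U_def)
      also have "card \<dots> = card (\<Union>i\<in>K. A i - U) + card U"
        using finK(2) finJ(2) by (subst card_Un_disjoint) auto
      finally show ?thesis using J(3) by (simp add: U_def)
    qed
    moreover have "card (I - J) < card I" using J(1,2) fin(1) by (intro psubset_card_mono) auto
    ultimately obtain \<psi> where \<psi>: "inj_on \<psi> (I - J)" "\<And>i. i \<in> I - J \<Longrightarrow> \<psi> i \<in> A i - U"
      using less.hyps[of "I - J" "\<lambda>i. A i - U"] fin by auto
    have "\<phi> i \<in> U" if "i \<in> J" for i using \<phi>(2)[OF that] that by (auto simp: U_def)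
    then have "\<phi> i \<noteq> \<psi> j" if "i \<in> J" "j \<in> I - J" for i j using \<psi>(2)[OF that(2)] that(1) by (metis DiffE)
    then have "inj_on (\<lambda>i. if i \<in> J then \<phi> i else \<psi> i) I"
      using \<phi>(1) \<psi>(1) unfolding inj_on_def by (metis DiffI)
    moreover have "(if i \<in> J then \<phi> i else \<psi> i) \<in> A i" if "i \<in> I" for i
      using \<phi>(2) \<psi>(2) that by auto
    ultimately show ?thesis by blast
  next
    case False
    show ?thesis
    proof (cases "I = {}")
      case True
      then show ?thesis by simp
    next
      case ne: False
      then obtain i where i: "i \<in> I" by blast
      have "card (A i) \<ge> 1" using hc[of "{i}"] i by simp
      then obtain a where a: "a \<in> A i" by fastforce
      have "card K \<le> card (\<Union>j\<in>K. A j - {a})" if K: "K \<subseteq> I - {i}" for K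
      proof (cases "K = {}")
        case False
        have "card K \<noteq> card (\<Union>j\<in>K. A j)" using \<open>\<nexists>J. _ J\<close> K False i by blast
        then have less: "card K < card (\<Union>j\<in>K. A j)" using hc[of K] K by force
        have "card (\<Union>j\<in>K. A j) - card {a} \<le> card ((\<Union>j\<in>K. A j) - {a})"
          by (rule diff_card_le_card_Diff) simp
        also have "(\<Union>j\<in>K. A j) - {a} = (\<Union>j\<in>K. A j - {a})" by blast
        finally have "card (\<Union>j\<in>K. A j) - 1 \<le> card (\<Union>j\<in>K. A j - {a})"
          by (simp only: card_insert_disjoint card.empty finite.emptyI empty_iff not_False_eq_True One_nat_def)
        then show ?thesis using less by linarith
      qed simp
      moreover have "card (I - {i}) < card I" using i fin(1) by (meson card_Diff1_less)
      ultimately obtain \<phi> where \<phi>: "inj_on \<phi> (I - {i})" "\<And>j. j \<in> I - {i} \<Longrightarrow> \<phi> j \<in> A j - {a}"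
        using less.hyps[of "I - {i}" "\<lambda>j. A j - {a}"] fin by (metis DiffD1 finite_Diff)
      have "inj_on (\<phi>(i := a)) I"
        unfolding inj_on_def
      proof (intro ballI impI)
        fix j k assume jk: "j \<in> I" "k \<in> I" "(\<phi>(i := a)) j = (\<phi>(i := a)) k"
        have "\<phi> l \<noteq> a" if "l \<in> I" "l \<noteq> i" for l using \<phi>(2)[of l] that by blast
        then show "j = k" using jk inj_onD[OF \<phi>(1), of j k] by (auto split: if_splits)
      qed
      moreover have "(\<phi>(i := a)) j \<in> A j" if "j \<in> I" for j using \<phi>(2) a that by auto
      ultimately show ?thesis by blast
    qed
  qed
qed

text \<open>Hall's condition by double counting: \<open>J\<close> covers at least \<open>n * card J\<close> points, and each value of \<open>r\<close> takes
care of at most \<open>n\<close> of them.\<close>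

lemma representatives_of_fibres:
  assumes "finite I" "n > 0" "\<And>i. i \<in> I \<Longrightarrow> finite (T i)"
    and disj: "\<And>i j. i \<in> I \<Longrightarrow> j \<in> I \<Longrightarrow> i \<noteq> j \<Longrightarrow> T i \<inter> T j = {}"
    and large: "\<And>i. i \<in> I \<Longrightarrow> n \<le> card (T i)"
    and fibre: "\<And>s. card {t \<in> \<Union>(T ` I). r t = s} \<le> n"
  shows "\<exists>\<phi>. inj_on \<phi> I \<and> (\<forall>i\<in>I. \<phi> i \<in> r ` T i)"
proof (rule hall[OF assms(1)])
  show "finite (r ` T i)" if "i \<in> I" for i using assms(3)[OF that] by simp
  fix J assume J: "J \<subseteq> I"
  define U where "U = \<Union>(T ` J)"
  have finJ: "finite J" using J assms(1) finite_subset by blast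
  have fin: "finite U" "finite (\<Union>(T ` I))" using J finJ assms(1,3) by (auto simp: U_def)
  have "n * card J = (\<Sum>i\<in>J. n)" by simp
  also have "\<dots> \<le> (\<Sum>i\<in>J. card (T i))" using large J by (intro sum_mono) auto
  also have "\<dots> = card U"
    unfolding U_def using J assms(3) disj finJ by (intro card_UN_disjoint[symmetric]) blast+
  also have "U = (\<Union>s\<in>r ` U. {t \<in> U. r t = s})" by blast
  also have "card \<dots> \<le> (\<Sum>s\<in>r ` U. card {t \<in> U. r t = s})"
    using fin by (intro card_UN_le) simp
  also have "\<dots> \<le> (\<Sum>s\<in>r ` U. n)"
  proof (rule sum_mono)
    fix s
    have "card {t \<in> U. r t = s} \<le> card {t \<in> \<Union>(T ` I). r t = s}"
      using J by (intro card_mono finite_subset[OF _ fin(2)]) (auto simp: U_def)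
    then show "card {t \<in> U. r t = s} \<le> n" using fibre[of s] by simp
  qed
  also have "\<dots> = n * card (r ` U)" by simp
  also have "r ` U = (\<Union>i\<in>J. r ` T i)" by (auto simp: U_def)
  finally show "card J \<le> card (\<Union>i\<in>J. r ` T i)" using assms(2) by simp
qed

text \<open>As \<open>\<phi>\<close> is injective, orienting the edge \<open>{\<phi> i, \<psi> i}\<close> from \<open>\<phi> i\<close> to \<open>\<psi> i\<close> gives out-degree at most 1. So
in every vertex set \<open>S\<close> the average in-degree is at most 1, and some vertex has degree at most 2.\<close>

lemma functional_graph_coloring:
  assumes "finite R" "finite I" "inj_on \<phi> I"
    and R: "\<And>i. i \<in> I \<Longrightarrow> \<phi> i \<in> R \<and> \<psi> i \<in> R \<and> \<phi> i \<noteq> \<psi> i"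
    and L: "\<And>r. r \<in> R \<Longrightarrow> card (L r) \<ge> 3"
  shows "\<exists>c. (\<forall>r\<in>R. c r \<in> L r) \<and> (\<forall>i\<in>I. c (\<phi> i) \<noteq> c (\<psi> i))"
proof -
  define E where "E u v \<longleftrightarrow> (\<exists>i\<in>I. (u = \<phi> i \<and> v = \<psi> i) \<or> (u = \<psi> i \<and> v = \<phi> i))" for u v
  interpret adjacency E
  proof
    show "E v u" if "E u v" for u v using that unfolding E_def by blast
    show "\<not> E v v" for v using R unfolding E_def by metis
  qed
  have "\<exists>c. list_coloring R L c"
  proof (rule degenerate_coloring[OF assms(1)])
    fix S assume S: "S \<subseteq> R" "S \<noteq> {}"
    have finS: "finite S" using S assms(1) finite_subset by blast
    define In where "In s = {i \<in> I. \<psi> i = s \<and> \<phi> i \<in> S}" for s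
    have "(\<Sum>s\<in>S. card (In s)) = card (\<Union>s\<in>S. In s)"
      using finS assms(2) by (intro card_UN_disjoint[symmetric]) (auto simp: In_def)
    also have "\<dots> \<le> card {i \<in> I. \<phi> i \<in> S}"
      using assms(2) by (intro card_mono) (auto simp: In_def)
    also have "\<dots> \<le> card S"
      using assms(3) finS by (intro card_inj_on_le[of \<phi>]) (auto simp: inj_on_def)
    finally have total: "(\<Sum>s\<in>S. card (In s)) \<le> card S" .
    have "\<exists>s\<in>S. card (In s) \<le> 1"
    proof (rule ccontr)
      assume "\<not> ?thesis"
      then have "(\<Sum>s\<in>S. 2) \<le> (\<Sum>s\<in>S. card (In s))" by (intro sum_mono) force
      moreover have "card S > 0" using S(2) finS by (simp add: card_gt_0_iff)
      ultimately show False using total by simp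
    qed
    then obtain s where s: "s \<in> S" "card (In s) \<le> 1" by blast
    have out: "card (\<psi> ` {i \<in> I. \<phi> i = s}) \<le> 1"
    proof -
      have "card (\<psi> ` {i \<in> I. \<phi> i = s}) \<le> card {i \<in> I. \<phi> i = s}"
        using assms(2) by (simp add: card_image_le)
      also have "\<dots> \<le> card {s}"
        using assms(3) by (intro card_inj_on_le[of \<phi>]) (auto simp: inj_on_def)
      finally show ?thesis by simp
    qed
    have "card (\<phi> ` In s) \<le> 1"
      using s(2) card_image_le[of "In s" \<phi>] assms(2) by (simp add: In_def)
    moreover have "nbrs S s \<subseteq> \<psi> ` {i \<in> I. \<phi> i = s} \<union> \<phi> ` In s"
      by (auto simp: nbrs_def E_def In_def)
    then have "card (nbrs S s) \<le> card (\<psi> ` {i \<in> I. \<phi> i = s} \<union> \<phi> ` In s)"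
      using assms(2) by (intro card_mono) (auto simp: In_def)
    moreover have "\<dots> \<le> card (\<psi> ` {i \<in> I. \<phi> i = s}) + card (\<phi> ` In s)" by (rule card_Un_le)
    ultimately have "card (nbrs S s) \<le> 2" using out by linarith
    moreover have "card (L s) \<ge> 3" using L s(1) S(1) by blast
    ultimately show "\<exists>s\<in>S. card (nbrs S s) < card (L s)" using s(1) by force
  qed
  then obtain c where c: "list_coloring R L c" by blast
  have "c (\<phi> i) \<noteq> c (\<psi> i)" if "i \<in> I" for i
    using c R[OF that] that unfolding list_coloring_def E_def by blast
  then show ?thesis using c unfolding list_coloring_def by blast
qed

section \<open>Contracting forced vertices\<close>

text \<open>The common hypotheses of the two cases. \<open>L\<close> assigns allowed colors; the last two conditions say that
distinct vertices of \<open>P\<close> have distance at least 3. \<open>E\<close> relates only vertices of \<open>V\<close>, so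
that neighborhoods in \<open>V\<close> are complete neighborhoods.\<close>

locale forbidden_colors = adjacency E for E :: "'a \<Rightarrow> 'a \<Rightarrow> bool" (infix "\<sim>" 50) +
  fixes V P :: "'a set" and n :: nat and L :: "'a \<Rightarrow> nat set"
  assumes finite_V: "finite V" and adj_V: "u \<sim> v \<Longrightarrow> u \<in> V"
    and n_ge: "n \<ge> 4"
    and degree_le: "v \<in> V \<Longrightarrow> card (nbrs V v) \<le> n"
    and clique_le: "K \<subseteq> V \<Longrightarrow> clique K \<Longrightarrow> card K \<le> n"
    and P_V: "P \<subseteq> V"
    and L_sub: "v \<in> P \<Longrightarrow> L v \<subseteq> {1..n}"
    and L_full: "v \<notin> P \<Longrightarrow> L v = {1..n}"
    and L_card: "v \<in> P \<Longrightarrow> card (L v) \<ge> 2"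
    and P_nonadj: "u \<in> P \<Longrightarrow> v \<in> P \<Longrightarrow> \<not> u \<sim> v"
    and P_no_common: "u \<in> P \<Longrightarrow> v \<in> P \<Longrightarrow> w \<sim> u \<Longrightarrow> w \<sim> v \<Longrightarrow> u = v"
begin

text \<open>The set \<open>D \<union> {x, v}\<close> is a clique on \<open>n + 1\<close> vertices without the edge \<open>vx\<close>. In every coloring with \<open>n\<close> colors
\<open>v\<close> and \<open>x\<close> agree.\<close>

definition gadget :: "'a \<Rightarrow> 'a set \<Rightarrow> 'a \<Rightarrow> bool" where
  "gadget v D x \<longleftrightarrow> v \<in> P \<and> x \<noteq> v \<and> x \<notin> D \<and> card D = n - 1 \<and> clique (insert x D) \<and> (\<forall>d\<in>D. d \<sim> v)"

lemma adj_V_right: "u \<sim> v \<Longrightarrow> v \<in> V" using adj_V adj_sym by blast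

text \<open>Each vertex of \<open>D\<close> has its \<open>n\<close> neighbors inside the gadget, and \<open>x\<close> and \<open>v\<close> have \<open>n - 1\<close> neighbors in \<open>D\<close>, so
at most one neighbor elsewhere. The edge \<open>vx\<close> is missing because there is no clique on \<open>n + 1\<close> vertices.\<close>

lemma
  assumes g: "gadget v D x"
  shows gadget_finite: "finite D"
    and gadget_sub: "D \<subseteq> V" "x \<in> V" "v \<in> V"
    and gadget_nonadj: "\<not> v \<sim> x"
    and gadget_nbrs: "d \<in> D \<Longrightarrow> nbrs V d = insert v (insert x (D - {d}))"
    and gadget_notin_P: "D \<inter> P = {}" "x \<notin> P"
    and gadget_adj: "d \<in> D \<Longrightarrow> d \<sim> x" "d \<in> D \<Longrightarrow> d \<sim> v"
    and gadget_exits: "card (nbrs V x - D) \<le> 1" "card (nbrs V v - D) \<le> 1"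
proof -
  have D: "v \<in> P" "x \<noteq> v" "x \<notin> D" "card D = n - 1" "clique (insert x D)" "\<And>d. d \<in> D \<Longrightarrow> d \<sim> v"
    using g by (auto simp: gadget_def)
  show fin: "finite D" using D(4) n_ge card.infinite by fastforce
  have "D \<noteq> {}" using D(4) n_ge by auto
  then obtain d0 where d0: "d0 \<in> D" by blast
  show dx: "d \<sim> x" if "d \<in> D" for d using cliqueD[OF D(5), of d x] D(3) that by blast
  show "d \<sim> v" if "d \<in> D" for d using D(6) that .
  show sub: "D \<subseteq> V" "x \<in> V" "v \<in> V" using D(6) adj_V dx[OF d0] adj_V_right d0 by blast+
  have vD: "v \<notin> D" using D(6) adj_irrefl by blast
  show nonadj: "\<not> v \<sim> x"
  proof
    assume "v \<sim> x"
    have "v \<sim> d" if "d \<in> insert x D" for d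
      using that \<open>v \<sim> x\<close> adj_sym[OF D(6)] by blast
    then have "clique (insert v (insert x D))"
      using cliqueD[OF D(5)] adj_sym by (auto simp: clique_def)
    then have "card (insert v (insert x D)) \<le> n" using clique_le sub by simp
    then show False using D(2,3,4) vD fin n_ge by simp
  qed
  show "nbrs V d = insert v (insert x (D - {d}))" if d: "d \<in> D" for d
  proof (rule card_seteq[symmetric])
    show "finite (nbrs V d)" using finite_V by simp
    have "d \<sim> u" if "u \<in> D - {d}" for u
      using cliqueD[OF D(5), of d u] d that by blast
    then show "insert v (insert x (D - {d})) \<subseteq> nbrs V d"
      using D(6)[OF d] dx[OF d] sub unfolding nbrs_def by blast
    have "card (insert v (insert x (D - {d}))) = n"
      using D(2,3,4) vD fin n_ge d by simp
    then show "card (nbrs V d) \<le> card (insert v (insert x (D - {d})))"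
      using degree_le d sub(1) by auto
  qed
  show "D \<inter> P = {}" using D(1,6) P_nonadj by blast
  show "x \<notin> P" using P_no_common[OF D(1) _ D(6)[OF d0] dx[OF d0]] D(2) by blast
  have *: "card (nbrs V y - D) \<le> 1" if "D \<subseteq> nbrs V y" "y \<in> V" for y
    using degree_le[OF that(2)] D(4) card_Diff_subset[OF fin that(1)] n_ge by simp
  show "card (nbrs V x - D) \<le> 1" "card (nbrs V v - D) \<le> 1"
  proof -
    have "D \<subseteq> nbrs V x" "D \<subseteq> nbrs V v" using dx D(6) adj_sym sub by (auto simp: nbrs_def)
    then show "card (nbrs V x - D) \<le> 1" "card (nbrs V v - D) \<le> 1" using * sub by blast+
  qed
qed

text \<open>A common vertex of \<open>D\<close> and \<open>D'\<close> would be a common neighbor of \<open>v\<close> and \<open>v'\<close>; the other coincidences would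
require more than \<open>n\<close> neighbors of \<open>x\<close>, as \<open>n \<ge> 4\<close>.\<close>

lemma gadgets_disjoint:
  assumes g: "gadget v D x" "gadget v' D' x'" and ne: "v \<noteq> v'"
  shows "D \<inter> D' = {}" "x \<notin> D'" "x \<noteq> x'"
proof -
  have c: "card D = n - 1" "card D' = n - 1" "v \<in> P" "v' \<in> P" using g by (auto simp: gadget_def)
  show disj: "D \<inter> D' = {}"
    using gadget_adj(2)[OF g(1)] gadget_adj(2)[OF g(2)] P_no_common[OF c(3,4)] ne by blast
  have Dx: "D \<subseteq> nbrs V x"
    using gadget_adj(1)[OF g(1)] gadget_sub[OF g(1)] adj_sym by (auto simp: nbrs_def)
  show "x \<notin> D'"
  proof
    assume "x \<in> D'"
    then have "D \<subseteq> {v', x'}" using gadget_nbrs[OF g(2)] Dx disj by blast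
    then have "card D \<le> 2"
      using card_mono[of "{v', x'}" D] card_insert_le_m1[of 2 "{x'}" v'] by simp
    then show False using c n_ge by simp
  qed
  show "x \<noteq> x'"
  proof
    assume "x = x'"
    then have "D \<union> D' \<subseteq> nbrs V x"
      using gadget_adj(1)[OF g(2)] gadget_sub[OF g(2)] adj_sym Dx by (auto simp: nbrs_def)
    then have "card (D \<union> D') \<le> card (nbrs V x)" using finite_V by (intro card_mono) auto
    also have "\<dots> \<le> n" using degree_le gadget_sub[OF g(1)] by blast
    finally show False
      using card_Un_disjoint[OF gadget_finite[OF g(1)] gadget_finite[OF g(2)] disj] c n_ge by simp
  qed
qed

text \<open>\<open>Q\<close> collects the vertices of \<open>P\<close> that sit in a gadget; each is merged with its twin, and its fan (the set
\<open>D\<close> of a chosen gadget) is deleted. \<open>R\<close> is the part of \<open>P\<close> that is colored in advance, by a coloring \<open>c\<close>.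
The graph \<open>core_adj\<close> on \<open>core\<close> is the contracted graph, where the twin of \<open>v\<close> inherits the neighbors of \<open>v\<close>,
and \<open>free c\<close> gives the colors that are left after \<open>R\<close> has been colored.\<close>

definition "Q = {v \<in> P. \<exists>D x. gadget v D x}"
definition "R = P - Q"
definition "fan v = (SOME D. \<exists>x. gadget v D x)"
definition "twin v = (SOME x. gadget v (fan v) x)"
definition "core = V - P - \<Union> (fan ` Q)"
definition "core_adj u w \<longleftrightarrow> u \<in> core \<and> w \<in> core \<and>
  (u \<sim> w \<or> (\<exists>v\<in>Q. u = twin v \<and> v \<sim> w) \<or> (\<exists>v\<in>Q. w = twin v \<and> v \<sim> u))"
definition "core_list a = {k \<in> {1..n}. \<forall>v\<in>Q. a = twin v \<longrightarrow> k \<in> L v}"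
definition "free c a = core_list a - c ` nbrs R a"

lemma Q_gadget: "v \<in> Q \<Longrightarrow> gadget v (fan v) (twin v)"
  unfolding Q_def fan_def twin_def by (metis (mono_tags, lifting) mem_Collect_eq someI_ex)

lemma QR: "Q \<union> R = P" "Q \<inter> R = {}" "Q \<subseteq> P" "R \<subseteq> P" by (auto simp: Q_def R_def)

lemma finite_sets: "finite P" "finite Q" "finite R" "finite core"
proof -
  show "finite P" using finite_subset[OF P_V finite_V] .
  then show "finite Q" "finite R" using QR finite_subset by blast+
  show "finite core" using finite_V by (simp add: core_def)
qed

lemma twin_inj: "v \<in> Q \<Longrightarrow> v' \<in> Q \<Longrightarrow> twin v = twin v' \<Longrightarrow> v = v'"
  using gadgets_disjoint(3) Q_gadget by blast

lemma fan_inj: "v \<in> Q \<Longrightarrow> v' \<in> Q \<Longrightarrow> a \<in> fan v \<Longrightarrow> a \<in> fan v' \<Longrightarrow> v = v'"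
  using gadgets_disjoint(1) Q_gadget by blast

lemma twin_core: assumes "v \<in> Q" shows "twin v \<in> core"
proof -
  have "twin v \<notin> fan v'" if "v' \<in> Q" for v'
    using gadgets_disjoint(2)[OF Q_gadget[OF assms] Q_gadget[OF that]] Q_gadget[OF assms]
    by (cases "v = v'") (auto simp: gadget_def)
  then show ?thesis
    using gadget_sub(2)[OF Q_gadget[OF assms]] gadget_notin_P(2)[OF Q_gadget[OF assms]]
    by (auto simp: core_def)
qed

sublocale C: adjacency core_adj
proof
  show "core_adj v u" if "core_adj u v" for u v using that adj_sym unfolding core_adj_def by blast
  show "\<not> core_adj v v" for v
    using adj_irrefl gadget_nonadj[OF Q_gadget] unfolding core_adj_def by blast
qed

lemma core_list_twin: "v \<in> Q \<Longrightarrow> core_list (twin v) = L v"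
  using twin_inj L_sub QR(3) unfolding core_list_def by blast

lemma core_list_non_twin: "a \<notin> twin ` Q \<Longrightarrow> core_list a = {1..n}"
  by (auto simp: core_list_def)

lemma finite_free: "finite (free c a)" by (simp add: free_def core_list_def)

lemma nbrs_R_le: "card (nbrs R a) \<le> 1"
proof -
  have "r = s" if "r \<in> nbrs R a" "s \<in> nbrs R a" for r s
    using that P_no_common QR(4) unfolding nbrs_def by blast
  then show ?thesis by (metis One_nat_def card.empty card_le_Suc0_iff_eq finite_nbrs finite_sets(3))
qed

text \<open>Merging turns a neighbor \<open>v \<in> Q\<close> of \<open>a\<close> into the neighbor \<open>twin v\<close>, so it does not increase the degree of \<open>a\<close>, and
the neighbors in \<open>R\<close> are counted separately.\<close>

lemma card_contracted_nbrs:
  assumes "finite N" "nbrs core a \<union> nbrs P a \<subseteq> N"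
  shows "card (nbrs core a \<union> twin ` nbrs Q a) + card (nbrs R a) \<le> card N"
proof -
  have disj: "nbrs core a \<inter> nbrs Q a = {}" "(nbrs core a \<union> nbrs Q a) \<inter> nbrs R a = {}"
    using QR by (auto simp: nbrs_def core_def)
  have "card (nbrs core a \<union> twin ` nbrs Q a) \<le> card (nbrs core a) + card (twin ` nbrs Q a)"
    by (rule card_Un_le)
  also have "\<dots> \<le> card (nbrs core a) + card (nbrs Q a)"
    using finite_sets by (simp add: card_image_le)
  also have "\<dots> = card (nbrs core a \<union> nbrs Q a)"
    using disj(1) finite_sets by (simp add: card_Un_disjoint)
  finally have "card (nbrs core a \<union> twin ` nbrs Q a) + card (nbrs R a) \<le>
    card (nbrs core a \<union> nbrs Q a) + card (nbrs R a)" by simp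
  also have "\<dots> = card ((nbrs core a \<union> nbrs Q a) \<union> nbrs R a)"
    using disj(2) finite_sets by (subst card_Un_disjoint) auto
  also have "\<dots> \<le> card N"
    using assms QR by (intro card_mono) (auto simp: nbrs_def)
  finally show ?thesis .
qed

lemma card_core_nbrs_non_twin:
  assumes "a \<in> core" "a \<notin> twin ` Q"
  shows "card (C.nbrs core a) + card (nbrs R a) \<le> n"
proof -
  have "C.nbrs core a \<subseteq> nbrs core a \<union> twin ` nbrs Q a"
    using assms(2) adj_sym unfolding C.nbrs_def nbrs_def core_adj_def by blast
  then have "card (C.nbrs core a) \<le> card (nbrs core a \<union> twin ` nbrs Q a)"
    using finite_sets by (intro card_mono) auto
  moreover have "nbrs core a \<union> nbrs P a \<subseteq> nbrs V a" using P_V by (auto simp: nbrs_def core_def)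
  then have "card (nbrs core a \<union> twin ` nbrs Q a) + card (nbrs R a) \<le> card (nbrs V a)"
    using card_contracted_nbrs finite_V by simp
  moreover have "card (nbrs V a) \<le> n" using degree_le assms(1) by (simp add: core_def)
  ultimately show ?thesis by simp
qed

text \<open>The two edges that remain are the one that leaves the gadget at \<open>twin v\<close> and the one that leaves it at \<open>v\<close>.\<close>

lemma card_core_nbrs_twin:
  assumes v: "v \<in> Q"
  shows "card (C.nbrs core (twin v)) + card (nbrs R (twin v)) \<le> 2"
proof -
  note g = Q_gadget[OF v]
  have DV: "fan v \<inter> core = {}" using v by (auto simp: core_def)
  have "C.nbrs core (twin v) \<subseteq> (nbrs core (twin v) \<union> twin ` nbrs Q (twin v)) \<union> (nbrs V v - fan v)"
    using v twin_inj adj_sym adj_V_right DV unfolding C.nbrs_def nbrs_def core_adj_def by blast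
  then have "card (C.nbrs core (twin v)) \<le>
      card ((nbrs core (twin v) \<union> twin ` nbrs Q (twin v)) \<union> (nbrs V v - fan v))"
    using finite_sets finite_V by (intro card_mono) auto
  also have "\<dots> \<le> card (nbrs core (twin v) \<union> twin ` nbrs Q (twin v)) + card (nbrs V v - fan v)"
    by (rule card_Un_le)
  also have "\<dots> \<le> card (nbrs core (twin v) \<union> twin ` nbrs Q (twin v)) + 1"
    using gadget_exits(2)[OF g] by simp
  finally have "card (C.nbrs core (twin v)) \<le> card (nbrs core (twin v) \<union> twin ` nbrs Q (twin v)) + 1" .
  moreover have "nbrs core (twin v) \<union> nbrs P (twin v) \<subseteq> nbrs V (twin v) - fan v"
    using P_V gadget_notin_P(1)[OF g] DV by (auto simp: nbrs_def core_def)
  then have "card (nbrs core (twin v) \<union> twin ` nbrs Q (twin v)) + card (nbrs R (twin v)) \<le>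
      card (nbrs V (twin v) - fan v)"
    using card_contracted_nbrs finite_V by simp
  ultimately show ?thesis using gadget_exits(1)[OF g] by simp
qed

lemma card_free_ge: "card (core_list a) \<le> card (free c a) + card (nbrs R a)"
proof -
  have "card (core_list a) - card (c ` nbrs R a) \<le> card (free c a)"
    unfolding free_def using finite_sets by (intro diff_card_le_card_Diff) simp
  moreover have "card (c ` nbrs R a) \<le> card (nbrs R a)" using finite_sets by (simp add: card_image_le)
  ultimately show ?thesis by simp
qed

lemma card_core_nbrs_le_free:
  assumes "a \<in> core"
  shows "card (C.nbrs core a) \<le> card (free c a)"
proof (cases "a \<in> twin ` Q")
  case True
  then obtain v where v: "v \<in> Q" "a = twin v" by blast
  then have "card (core_list a) \<ge> 2" using core_list_twin L_card QR(3) by auto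
  then show ?thesis using card_free_ge[of a c] card_core_nbrs_twin[OF v(1)] v(2) by simp
next
  case False
  then show ?thesis using card_free_ge[of a c] card_core_nbrs_non_twin[OF assms False] core_list_non_twin by simp
qed

text \<open>Each \<open>v \<in> Q\<close> takes the color of its twin. The \<open>n - 1\<close> vertices of its fan have all their neighbors in the
gadget, so they can be given the \<open>n - 1\<close> other colors in any order.\<close>

lemma uncontract_coloring:
  assumes c: "\<And>r. r \<in> R \<Longrightarrow> c r \<in> L r" and f: "C.list_coloring core (free c) f"
  shows "\<exists>g. list_coloring V L g"
proof -
  have "\<exists>h. inj_on h (fan v) \<and> h ` fan v \<subseteq> {1..n} - {f (twin v)}" if v: "v \<in> Q" for v
  proof (rule inj_on_iff_card_le[THEN iffD2])
    show "finite (fan v)" using gadget_finite[OF Q_gadget[OF v]] .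
    show "finite ({1..n} - {f (twin v)})" by simp
    have "card {1..n} - card {f (twin v)} \<le> card ({1..n} - {f (twin v)})"
      by (intro diff_card_le_card_Diff) simp
    then show "card (fan v) \<le> card ({1..n} - {f (twin v)})"
      using Q_gadget[OF v] by (simp add: gadget_def)
  qed
  then obtain h where h: "\<And>v. v \<in> Q \<Longrightarrow> inj_on (h v) (fan v)"
    "\<And>v. v \<in> Q \<Longrightarrow> h v ` fan v \<subseteq> {1..n} - {f (twin v)}" by metis
  define own where "own a = (SOME v. v \<in> Q \<and> a \<in> fan v)" for a
  have own: "own a = v" if "v \<in> Q" "a \<in> fan v" for v a
    unfolding own_def by (rule some_equality) (use that fan_inj in auto)
  define g where "g a = (if a \<in> core then f a else if a \<in> R then c a
    else if a \<in> Q then f (twin a) else h (own a) a)" for a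
  have gV: "g a = f a" if "a \<in> core" for a using that by (simp add: g_def)
  have gR: "g a = c a" if "a \<in> R" for a using that QR by (auto simp: g_def core_def)
  have gQ: "g a = f (twin a)" if "a \<in> Q" for a using that QR by (auto simp: g_def core_def)
  have gD: "g a = h v a" if "v \<in> Q" "a \<in> fan v" for v a
    using that own[OF that] gadget_notin_P(1)[OF Q_gadget[OF that(1)]] QR by (auto simp: g_def core_def)
  have cases: "a \<in> core \<or> a \<in> R \<or> a \<in> Q \<or> (\<exists>v\<in>Q. a \<in> fan v)" if "a \<in> V" for a
    using that QR(1) by (auto simp: core_def)
  have fL: "f a \<in> free c a" if "a \<in> core" for a using f that by (auto simp: C.list_coloring_def)
  have fE: "f a \<noteq> f b" if "core_adj a b" for a b
  proof -
    have "a \<in> core" "b \<in> core" using that by (auto simp: core_adj_def)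
    then show ?thesis using f that unfolding C.list_coloring_def by blast
  qed
  have proper: "g a \<noteq> g b" if ab: "a \<in> core" "a \<sim> b" "b \<notin> \<Union> (fan ` Q)" for a b
  proof -
    consider "b \<in> core" | "b \<in> R" | "b \<in> Q" using cases[of b] adj_V_right[OF ab(2)] ab(3) by blast
    then show ?thesis
    proof cases
      case 1
      then have "core_adj a b" using ab by (simp add: core_adj_def)
      then show ?thesis using fE gV ab(1) 1 by simp
    next
      case 2
      then have "b \<in> nbrs R a" using ab(2) by (simp add: nbrs_def)
      then have "f a \<noteq> c b" using fL[OF ab(1)] by (auto simp: free_def)
      then show ?thesis using gV ab(1) gR 2 by simp
    next
      case 3
      then have "core_adj a (twin b)" using ab(1) twin_core adj_sym[OF ab(2)] by (auto simp: core_adj_def)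
      then show ?thesis using fE gV ab(1) gQ 3 by simp
    qed
  qed
  have properD: "g a \<noteq> g b" if vab: "v \<in> Q" "a \<in> fan v" "a \<sim> b" for a b v
  proof -
    note gd = Q_gadget[OF vab(1)]
    have ha: "g a = h v a" "h v a \<noteq> f (twin v)" using gD[OF vab(1,2)] h(2)[OF vab(1)] vab(2) by auto
    have "b \<in> nbrs V a" using vab(3) adj_V_right by (simp add: nbrs_def)
    then consider "b = v" | "b = twin v" | "b \<in> fan v" "b \<noteq> a"
      using gadget_nbrs[OF gd vab(2)] by blast
    then show ?thesis
    proof cases
      case 1
      then show ?thesis using ha gQ vab(1) by simp
    next
      case 2
      then show ?thesis using ha gV twin_core[OF vab(1)] by simp
    next
      case 3
      then show ?thesis using ha(1) gD[OF vab(1) 3(1)] inj_onD[OF h(1)[OF vab(1)], of a b] vab(2) by auto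
    qed
  qed
  have "list_coloring V L g"
    unfolding list_coloring_def
  proof (intro conjI ballI impI)
    fix a assume "a \<in> V"
    then consider "a \<in> core" | "a \<in> R" | "a \<in> Q" | v where "v \<in> Q" "a \<in> fan v" using cases by blast
    then show "g a \<in> L a"
    proof cases
      case 1
      then have "g a \<in> {1..n}" using fL[OF 1] gV[OF 1] by (simp add: free_def core_list_def)
      moreover have "a \<notin> P" using 1 by (simp add: core_def)
      ultimately show ?thesis using L_full by simp
    next
      case 2
      then show ?thesis using c gR by simp
    next
      case 3
      then show ?thesis using fL[OF twin_core[OF 3]] core_list_twin[OF 3] gQ[OF 3] by (simp add: free_def)
    next
      case 4
      have "a \<notin> P" using gadget_notin_P(1)[OF Q_gadget[OF 4(1)]] 4(2) by blast
      then show ?thesis using gD[OF 4] h(2)[OF 4(1)] 4(2) L_full by auto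
    qed
  next
    fix a b assume ab: "a \<in> V" "b \<in> V" "a \<sim> b"
    show "g a \<noteq> g b"
    proof (cases "a \<in> \<Union> (fan ` Q) \<or> b \<in> \<Union> (fan ` Q)")
      case True
      then show ?thesis using properD[of _ a b] properD[of _ b a] ab(3) adj_sym[OF ab(3)] by force
    next
      case False
      have "a \<in> core \<or> b \<in> core"
        using False ab P_nonadj by (auto simp: core_def)
      then show ?thesis
        using proper[of a b] proper[of b a] ab(3) adj_sym[OF ab(3)] False by force
    qed
  qed
  then show ?thesis by blast
qed

lemma core_adj_non_twin: "a \<in> core \<Longrightarrow> b \<in> core \<Longrightarrow> a \<notin> twin ` Q \<Longrightarrow> b \<notin> twin ` Q \<Longrightarrow> core_adj a b \<longleftrightarrow> a \<sim> b"
  unfolding core_adj_def by blast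

lemma clique_non_twin:
  assumes "K \<subseteq> core" "K \<inter> twin ` Q = {}"
  shows "C.clique K \<longleftrightarrow> clique K"
proof -
  have "core_adj a b \<longleftrightarrow> a \<sim> b" if "a \<in> K" "b \<in> K" for a b
    using that assms by (intro core_adj_non_twin) auto
  then show ?thesis unfolding clique_def C.clique_def by blast
qed

lemma twin_exit_unique:
  assumes v: "v \<in> Q" and "a \<in> core" "b \<in> core" "twin v \<sim> a" "twin v \<sim> b"
  shows "a = b"
proof -
  have "a \<in> nbrs V (twin v) - fan v" "b \<in> nbrs V (twin v) - fan v"
    using assms by (auto simp: nbrs_def core_def)
  moreover have "card (nbrs V (twin v) - fan v) \<le> 1" using gadget_exits(1)[OF Q_gadget[OF v]] .
  ultimately show ?thesis using finite_V by (metis One_nat_def card_le_Suc0_iff_eq finite_Diff finite_nbrs)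
qed

lemma card_nbrs_free:
  assumes "C.closed_in core H" "C.blocked H (free c)" "a \<in> H"
  shows "card (C.nbrs core a) = card (free c a)"
proof -
  have "C.nbrs H a = C.nbrs core a"
    using assms(1,3) unfolding C.closed_in_def C.nbrs_def by blast
  then show ?thesis using C.blocked_tight[OF assms(2,3)] by simp
qed

text \<open>The end blocks of an uncolored component \<open>H\<close> that can become bad: cliques on \<open>n\<close> vertices, free of twins, in
which every non-cut vertex has a neighbor in \<open>R\<close>.\<close>

definition loaded :: "'a set \<Rightarrow> 'a set \<Rightarrow> bool" where
  "loaded H D \<longleftrightarrow> (\<exists>x\<in>H. C.sep H D x \<and> insert x D \<inter> twin ` Q = {} \<and> clique (insert x D) \<and>
     card D = n - 1 \<and> (\<forall>d\<in>D. nbrs R d \<noteq> {}))"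

text \<open>One vertex \<open>d0\<close> that is not a twin has at least \<open>n - 1 \<ge> 3\<close> colors left, so the end block is a clique of degree at
least 3 and contains no twin. There is no clique on \<open>n + 1\<close> vertices, hence the common list has exactly
\<open>n - 1\<close> colors, and each vertex of \<open>D\<close> has lost one to a neighbor in \<open>R\<close>.\<close>

lemma leaf_loaded:
  assumes H: "C.closed_in core H" "C.blocked H (free c)"
    and D: "C.leaf H D x" "d0 \<in> D" "d0 \<notin> twin ` Q"
  shows "x \<in> H" "C.sep H D x" "insert x D \<inter> twin ` Q = {}" "clique (insert x D)"
    "card D = n - 1" "\<And>d. d \<in> D \<Longrightarrow> nbrs R d \<noteq> {}"
proof -
  define B where "B = H \<inter> insert x D"
  obtain K where K: "\<And>d. d \<in> D \<Longrightarrow> free c d = K" "\<And>b. b \<in> B \<Longrightarrow> card (C.nbrs B b) = card K"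
    "3 \<le> card K \<Longrightarrow> C.clique B" "K \<noteq> {} \<Longrightarrow> x \<in> H"
    using C.blocked_leaf_block[OF H(2) D(1)] unfolding B_def by metis
  show sep: "C.sep H D x" using D(1) by (simp add: C.leaf_def)
  have HV: "H \<subseteq> core" "finite H" using H(1) finite_sets(4) finite_subset by (auto simp: C.closed_in_def)
  have D': "D \<subseteq> H" "x \<notin> D" using sep by (auto simp: C.sep_def)
  have "card (free c d0) \<ge> n - 1"
    using card_free_ge[of d0 c] core_list_non_twin[OF D(3)] nbrs_R_le[of d0] by simp
  then have K3: "card K \<ge> n - 1" "card K \<ge> 3" using K(1)[OF D(2)] n_ge by auto
  then show x: "x \<in> H" using K(4) by fastforce
  have B: "B = insert x D" using x D' by (auto simp: B_def)
  have cB: "C.clique B" using K(3) K3 by blast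
  have noX: "b \<notin> twin ` Q" if "b \<in> B" for b
  proof
    assume "b \<in> twin ` Q"
    then have "card (C.nbrs core b) \<le> 2" using card_core_nbrs_twin by force
    moreover have "card (C.nbrs B b) \<le> card (C.nbrs core b)"
      using HV finite_sets(4) by (intro card_mono C.nbrs_mono C.finite_nbrs) (auto simp: B_def)
    ultimately show False using K(2)[OF that] K3 by simp
  qed
  then show iX: "insert x D \<inter> twin ` Q = {}" using B by blast
  have BV: "B \<subseteq> core" "finite B" using HV by (auto simp: B_def)
  show cl: "clique (insert x D)" using clique_non_twin[OF BV(1)] cB iX B by simp
  have "insert x D \<subseteq> V" using BV B by (auto simp: core_def)
  then have "card B \<le> n" using clique_le cl B by simp
  moreover have "card K = card B - 1"
    using C.card_nbrs_clique[OF BV(2) cB, of x] K(2)[of x] B by simp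
  ultimately have cK: "card K = n - 1" "card B = n" using K3 n_ge by linarith+
  then show "card D = n - 1" using B D'(2) BV(2) by simp
  show "nbrs R d \<noteq> {}" if d: "d \<in> D" for d
  proof
    assume "nbrs R d = {}"
    then have "free c d = {1..n}" using core_list_non_twin[of d] noX[of d] d B by (simp add: free_def)
    then show False using K(1)[OF d] cK(1) n_ge by simp
  qed
qed

text \<open>Otherwise \<open>r\<close>, \<open>D\<close> and the cut vertex form a gadget, and \<open>r\<close> would belong to \<open>Q\<close>.\<close>

lemma loaded_two_neighbours:
  assumes "H \<subseteq> core" "loaded H D" "r \<in> R"
  shows "\<exists>d\<in>D. \<not> d \<sim> r"
proof (rule ccontr)
  assume *: "\<not> ?thesis"
  obtain x where x: "x \<in> H" "C.sep H D x" "clique (insert x D)" "card D = n - 1"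
    using assms(2) unfolding loaded_def by blast
  have "x \<noteq> r" using x(1) assms(1,3) QR by (auto simp: core_def)
  then have "gadget r D x" using x * assms(3) QR by (auto simp: gadget_def C.sep_def)
  then have "r \<in> Q" using assms(3) QR unfolding Q_def by blast
  then show False using assms(3) QR by blast
qed

lemma loaded_adj:
  assumes "loaded H D" "d \<in> D" "d' \<in> D" "d \<noteq> d'"
  shows "d \<sim> d'"
proof -
  obtain x where "clique (insert x D)" using assms(1) unfolding loaded_def by blast
  then show ?thesis using cliqueD[of "insert x D" d d'] assms(2-4) by blast
qed

text \<open>A vertex of a loaded end block is not a cut vertex of \<open>H\<close>, so its list is contained in those of its
neighbors.\<close>

lemma loaded_equal_lists:
  assumes H: "H \<subseteq> core" "C.blocked H (free c)" and D: "loaded H D" "d \<in> D" "d' \<in> D"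
  shows "free c d \<subseteq> free c d'"
proof (cases "d = d'")
  case False
  obtain x where x: "x \<in> H" "C.sep H D x" "insert x D \<inter> twin ` Q = {}" "clique (insert x D)"
    using D(1) unfolding loaded_def by blast
  have DH: "D \<subseteq> H" using x(2) by (simp add: C.sep_def)
  have "insert x D \<subseteq> core" using DH x(1) H(1) by blast
  then have cl: "C.clique (insert x D)" using clique_non_twin x(3,4) by simp
  then have "C.conn (H - {d})"
    using C.leaf_remove_conn[OF _ C.clique_leaf[OF x(2,1) cl] D(2)] H(2) by (simp add: C.blocked_def)
  moreover have "core_adj d d'" using C.cliqueD[OF cl, of d d'] D(2,3) False by blast
  ultimately show ?thesis using C.blocked_list_subset[OF H(2)] D(2,3) DH by blast
qed simp

lemma leaf_below:
  assumes H: "C.blocked H (free c)" and a: "a \<in> H" "free c a \<noteq> {}"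
  obtains D x where "C.leaf H D x"
proof -
  have fin: "finite H" using H by (simp add: C.blocked_def)
  have "card (C.nbrs H a) > 0"
    using C.blocked_tight[OF H a(1)] a(2) finite_free by (simp add: card_gt_0_iff)
  then obtain b where "b \<in> C.nbrs H a" by (metis card_gt_0_iff equals0I)
  then have "b \<in> H - {a}" using C.adj_irrefl by (auto simp: C.nbrs_def)
  then have "C.sep H (H - {a}) a" by (auto simp: C.sep_def C.nbrs_def)
  then show ?thesis using C.leaf_exists[OF fin] that by metis
qed

lemma blocked_component_exists:
  assumes "\<And>r. r \<in> R \<Longrightarrow> c r \<in> L r" "\<nexists>g. list_coloring V L g"
  obtains H where "C.closed_in core H" "C.blocked H (free c)"
proof -
  have "\<nexists>f. C.list_coloring core (free c) f" using uncontract_coloring assms by blast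
  from C.blocked_component[OF finite_sets(4) finite_free card_core_nbrs_le_free this]
  obtain H where "C.closed_in core H" "C.blocked H (free c)" .
  then show ?thesis by (rule that)
qed

text \<open>Adjacent vertices of a loaded end block have the same neighbor in \<open>R\<close>, which would make it part of a
gadget. In a bad end block made of twins, two adjacent twins would both be adjacent to the cut vertex \<open>x\<close>
through the vertices of \<open>P\<close> that they represent, and these would have \<open>x\<close> as a common neighbor.\<close>

theorem far_coloring:
  assumes far: "\<And>u v a b. u \<in> P \<Longrightarrow> v \<in> P \<Longrightarrow> u \<sim> a \<Longrightarrow> a \<sim> b \<Longrightarrow> b \<sim> v \<Longrightarrow> u = v"
  shows "\<exists>g. list_coloring V L g"
proof (rule ccontr)
  assume nc: "\<not> ?thesis"
  have "\<exists>k. k \<in> L r" if "r \<in> R" for r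
  proof -
    have "L r \<noteq> {}" using L_card[of r] that QR by force
    then show ?thesis by blast
  qed
  then obtain c where c: "\<And>r. r \<in> R \<Longrightarrow> c r \<in> L r" by metis
  obtain H where H: "C.closed_in core H" "C.blocked H (free c)"
    using blocked_component_exists[OF c nc] by blast
  have HV: "H \<subseteq> core" using H(1) by (simp add: C.closed_in_def)
  have twin_R: "nbrs P (twin v) = {}" if v: "v \<in> Q" for v
  proof (rule ccontr)
    note g = Q_gadget[OF v]
    assume "nbrs P (twin v) \<noteq> {}"
    then obtain p where p: "p \<in> P" "twin v \<sim> p" by (auto simp: nbrs_def)
    have "fan v \<noteq> {}" using g n_ge by (auto simp: gadget_def)
    then obtain d where d: "d \<in> fan v" by blast
    have "v = p"
      using far[of v p d "twin v"] gadget_adj[OF g d] p adj_sym v QR(3) by blast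
    then show False using p gadget_nonadj[OF g] adj_sym by blast
  qed
  have free2: "card (free c a) \<ge> 2" for a
  proof (cases "a \<in> twin ` Q")
    case True
    then obtain v where v: "v \<in> Q" "a = twin v" by blast
    then have "nbrs R a = {}" using twin_R QR(4) by (auto simp: nbrs_def)
    then show ?thesis using card_free_ge[of a c] L_card[of v] v core_list_twin QR(3) by auto
  next
    case False
    then show ?thesis using card_free_ge[of a c] core_list_non_twin nbrs_R_le[of a] n_ge by simp
  qed
  obtain a where "a \<in> H" using H(2) by (auto simp: C.blocked_def)
  moreover have "free c a \<noteq> {}" using free2[of a] by force
  ultimately obtain D x where D: "C.leaf H D x" using leaf_below[OF H(2)] by blast
  then have DH: "D \<subseteq> H" "D \<noteq> {}" "x \<notin> D" by (auto simp: C.leaf_def C.sep_def)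
  show False
  proof (cases "D \<subseteq> twin ` Q")
    case False
    then obtain d0 where d0: "d0 \<in> D" "d0 \<notin> twin ` Q" by blast
    note ld = leaf_loaded[OF H D d0]
    have dg: "loaded H D" using ld unfolding loaded_def by blast
    obtain r where r: "r \<in> R" "d0 \<sim> r" using ld(6)[OF d0(1)] by (auto simp: nbrs_def)
    obtain d where d: "d \<in> D" "\<not> d \<sim> r" using loaded_two_neighbours[OF HV dg r(1)] by blast
    obtain s where s: "s \<in> R" "d \<sim> s" using ld(6)[OF d(1)] by (auto simp: nbrs_def)
    have "d0 \<sim> d" using loaded_adj[OF dg d0(1) d(1)] d(2) r(2) by blast
    then have "r = s" using far[of r s d0 d] r s QR(4) adj_sym by blast
    then show False using d s by blast
  next
    \<comment> \<open>All non-cut vertices of the end block are twins, hence of degree 2 in the block.\<close>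
    case True
    obtain K where K: "\<And>d. d \<in> D \<Longrightarrow> free c d = K"
      "\<And>b. b \<in> H \<inter> insert x D \<Longrightarrow> card (C.nbrs (H \<inter> insert x D) b) = card K"
      using C.blocked_leaf_block[OF H(2) D] by metis
    have twin_adj: "twin v \<sim> twin v'" if "v \<in> Q" "v' \<in> Q" "core_adj (twin v) (twin v')" for v v'
    proof -
      have no: "\<not> w \<sim> twin w'" if w: "w \<in> Q" "w' \<in> Q" for w w'
      proof
        assume adj: "w \<sim> twin w'"
        then have "w \<in> nbrs P (twin w')" using w QR(3) adj_sym by (auto simp: nbrs_def)
        then show False using twin_R[OF w(2)] by simp
      qed
      show ?thesis using that no twin_inj unfolding core_adj_def by metis
    qed
    \<comment> \<open>Of the two neighbors of a twin in the block, only one can be a twin; the other is \<open>x\<close>.\<close>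
    have neighbours: "core_adj (twin v) x \<and> x \<notin> twin ` Q \<and> (\<exists>v'\<in>Q. twin v' \<in> D \<and> twin v \<sim> twin v')"
      if v: "v \<in> Q" "twin v \<in> D" for v
    proof -
      have "card (C.nbrs (H \<inter> insert x D) (twin v)) \<ge> 2"
        using K(1)[OF v(2)] K(2)[of "twin v"] v(2) DH free2[of "twin v"] by auto
      then obtain y z where yz: "y \<in> C.nbrs (H \<inter> insert x D) (twin v)"
          "z \<in> C.nbrs (H \<inter> insert x D) (twin v)" "y \<noteq> z"
        using finite_subset[OF HV finite_sets(4)] card_le_Suc0_iff_eq[of "C.nbrs (H \<inter> insert x D) (twin v)"]
        by fastforce
      have X: "b \<in> core" "twin v \<sim> b" if "core_adj (twin v) b" "b \<in> twin ` Q" for b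
        using that v(1) twin_adj by (auto simp: core_adj_def)
      have yz': "core_adj (twin v) y" "core_adj (twin v) z" "y \<in> insert x D" "z \<in> insert x D"
        using yz by (auto simp: C.nbrs_def)
      have "y \<notin> twin ` Q \<or> z \<notin> twin ` Q"
        using X yz'(1,2) yz(3) twin_exit_unique[OF v(1)] by blast
      then obtain d where "core_adj (twin v) x" "x \<notin> twin ` Q" "d \<in> D" "core_adj (twin v) d"
        using yz' yz(3) True by blast
      then show ?thesis using True twin_adj v(1) by blast
    qed
    obtain v where v: "v \<in> Q" "twin v \<in> D" using True DH(2) by blast
    obtain v' where v': "v' \<in> Q" "twin v' \<in> D" "twin v \<sim> twin v'" using neighbours[OF v] by blast
    \<comment> \<open>The only edge that leaves the gadget of \<open>u\<close> at its twin goes to another twin, so the edge to \<open>x\<close> comes from \<open>u\<close>.\<close>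
    have touch: "u \<sim> x" if u: "u \<in> Q" "twin u \<in> D" "w \<in> Q" "twin u \<sim> twin w" for u w
    proof -
      have x: "core_adj (twin u) x" "x \<notin> twin ` Q" using neighbours[OF u(1,2)] by auto
      have "\<not> twin u \<sim> x"
        using twin_exit_unique[OF u(1), of x "twin w"] x u twin_core by (auto simp: core_adj_def)
      then show ?thesis using x twin_inj u(1) unfolding core_adj_def by blast
    qed
    have "v \<sim> x" "v' \<sim> x" using touch[OF v v'(1,3)] touch[OF v'(1,2) v(1) adj_sym[OF v'(3)]] by auto
    then have "v = v'" using P_no_common[of v v' x] v v' QR(3) adj_sym by blast
    then show False using v'(3) adj_irrefl by blast
  qed
qed

text \<open>A blocked component is either a clique on \<open>n\<close> vertices, each with a neighbor in \<open>R\<close>, where any vertex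
can serve as the cut vertex, or it has two disjoint loaded end blocks with \<open>n - 1\<close> vertices each.\<close>

lemma loaded_many_vertices:
  assumes H: "C.closed_in core H" "C.blocked H (free c)" "H \<inter> twin ` Q = {}"
  shows "n \<le> card (\<Union> {D. loaded H D})"
proof -
  have HV: "H \<subseteq> core" "finite H" using H(1) finite_sets(4) finite_subset by (auto simp: C.closed_in_def)
  have "{D. loaded H D} \<subseteq> Pow H" by (auto simp: loaded_def C.sep_def)
  then have finT: "finite (\<Union> {D. loaded H D})"
    using HV(2) by (meson Sup_le_iff PowD finite_subset subsetD)
  have free: "free c a \<noteq> {}" if "a \<in> H" for a
    using card_free_ge[of a c] core_list_non_twin[of a] nbrs_R_le[of a] n_ge that H(3) by force
  obtain a where "a \<in> H" using H(2) by (auto simp: C.blocked_def)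
  then obtain D x where D: "C.leaf H D x" using leaf_below[OF H(2)] free by blast
  have sep: "C.sep H D x" using D by (simp add: C.leaf_def)
  then have DH: "D \<subseteq> H" "D \<noteq> {}" "x \<notin> D" by (auto simp: C.sep_def)
  then obtain d where d: "d \<in> D" by blast
  note ld = leaf_loaded[OF H(1,2) D]
  have xH: "x \<in> H" and cl: "clique (insert x D)" and cD: "card D = n - 1"
    and RD: "\<And>d. d \<in> D \<Longrightarrow> nbrs R d \<noteq> {}"
    using ld[OF d] d H(3) DH(1) by blast+
  have dg: "loaded H D" using sep xH cl cD RD H(3) DH(1) unfolding loaded_def by blast
  show ?thesis
  proof (cases "H = insert x D")
    case True
    have clC: "C.clique H" using clique_non_twin[OF HV(1) H(3)] cl True by simp
    have cH: "card H = n" using True DH(3) cD n_ge HV(2) by simp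
    have "nbrs R x \<noteq> {}"
    proof
      assume "nbrs R x = {}"
      then have "free c x = {1..n}" using core_list_non_twin[of x] H(3) xH by (auto simp: free_def)
      then show False
        using C.blocked_tight[OF H(2) xH] C.card_nbrs_clique[OF HV(2) clC xH] cH n_ge by simp
    qed
    then have RH: "nbrs R b \<noteq> {}" if "b \<in> H" for b using that True RD by blast
    have del: "loaded H (H - {b})" if b: "b \<in> H" for b
    proof -
      have cb: "card (H - {b}) = n - 1" using cH b HV(2) by simp
      then have "H - {b} \<noteq> {}" using n_ge by force
      then have "C.sep H (H - {b}) b" by (auto simp: C.sep_def C.nbrs_def)
      moreover have "insert b (H - {b}) = H" using b by blast
      ultimately show ?thesis using b cb cl True RH H(3) unfolding loaded_def by (intro bexI[of _ b]) auto
    qed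
    have "H \<subseteq> \<Union> {D. loaded H D}"
    proof
      fix b assume b: "b \<in> H"
      have "d \<noteq> x" "d \<in> H" using d DH by auto
      then have "b \<in> H - {x} \<or> b \<in> H - {d}" using b by blast
      then show "b \<in> \<Union> {D. loaded H D}" using del[OF xH] del[OF \<open>d \<in> H\<close>] by blast
    qed
    then show ?thesis using card_mono[OF finT] cH by metis
  next
    case False
    have "C.sep H (H - insert x D) x"
      unfolding C.sep_def
    proof (intro conjI ballI subsetI)
      show "H - insert x D \<noteq> {}" using False xH DH(1) by blast
      fix y z assume y: "y \<in> H - insert x D" and z: "z \<in> C.nbrs H y"
      have "z \<notin> D"
      proof
        assume "z \<in> D"
        moreover have "y \<in> C.nbrs H z" using y z C.adj_sym by (auto simp: C.nbrs_def)
        ultimately show False using sep y unfolding C.sep_def by blast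
      qed
      then show "z \<in> insert x (H - insert x D)" using z by (auto simp: C.nbrs_def)
    qed auto
    then obtain D2 x2 where D2: "D2 \<subseteq> H - insert x D" "C.leaf H D2 x2"
      using C.leaf_exists[OF HV(2)] by metis
    then obtain d2 where d2: "d2 \<in> D2" by (auto simp: C.leaf_def C.sep_def)
    have "d2 \<notin> twin ` Q" using d2 D2(1) H(3) by blast
    note ld2 = leaf_loaded[OF H(1,2) D2(2) d2 this]
    have dg2: "loaded H D2" "card D2 = n - 1"
      unfolding loaded_def using ld2 by (auto intro!: bexI[of _ x2])
    have "finite D" "finite D2" using DH(1) D2(1) HV(2) finite_subset by blast+
    then have "card (D \<union> D2) = card D + card D2" using D2(1) by (intro card_Un_disjoint) auto
    moreover have "card (D \<union> D2) \<le> card (\<Union> {D. loaded H D})"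
      using dg dg2 finT by (intro card_mono) auto
    ultimately show ?thesis using cD dg2(2) n_ge by simp
  qed
qed

text \<open>A blocked component has equal lists on each loaded end block. So it suffices that for every component
with many loaded vertices two vertices of \<open>R\<close> that are attached to the same loaded end block get different
colors, and these pairs can be fixed before \<open>R\<close> is colored.\<close>

theorem three_colors_coloring:
  assumes L3: "\<And>v. v \<in> P \<Longrightarrow> card (L v) \<ge> 3"
  shows "\<exists>g. list_coloring V L g"
proof (rule ccontr)
  assume nc: "\<not> ?thesis"
  define T where "T H = \<Union> {D. loaded H D}" for H
  \<comment> \<open>The dangerous components; this family does not depend on the colors on \<open>R\<close>.\<close>
  define I where "I = {H. H \<noteq> {} \<and> C.closed_in core H \<and> C.conn H \<and> n \<le> card (T H)}"
  define r where "r t = (SOME s. s \<in> nbrs R t)" for t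
  have IV: "H \<subseteq> core" if "H \<in> I" for H using that by (simp add: I_def C.closed_in_def)
  then have "I \<subseteq> Pow core" by blast
  then have finI: "finite I" using finite_sets(4) finite_subset by blast
  have TH: "T H \<subseteq> H" for H by (auto simp: T_def loaded_def C.sep_def)
  have finT: "finite (T H)" if "H \<in> I" for H
    using TH IV[OF that] finite_sets(4) by (meson finite_subset)
  have rT: "r t \<in> R" "t \<sim> r t" if "t \<in> T H" for t H
  proof -
    have "\<exists>s. s \<in> nbrs R t" using that by (auto simp: T_def loaded_def)
    then have "r t \<in> nbrs R t" unfolding r_def by (rule someI_ex)
    then show "r t \<in> R" "t \<sim> r t" by (auto simp: nbrs_def)
  qed
  have disjoint: "T H \<inter> T H' = {}" if HH: "H \<in> I" "H' \<in> I" "H \<noteq> H'" for H H'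
  proof -
    have "H \<inter> H' = {}"
    proof (rule ccontr)
      assume "H \<inter> H' \<noteq> {}"
      moreover have "C.closed_in H (H \<inter> H')" "C.closed_in H' (H \<inter> H')"
        using HH(1,2) unfolding I_def C.closed_in_def by blast+
      ultimately have "H \<inter> H' = H" "H \<inter> H' = H'"
        using HH(1,2) unfolding I_def C.conn_def by blast+
      then show False using HH(3) by blast
    qed
    then show ?thesis using TH by blast
  qed
  have "\<exists>\<phi>. inj_on \<phi> I \<and> (\<forall>H\<in>I. \<phi> H \<in> r ` T H)"
  proof (rule representatives_of_fibres[OF finI])
    show "n > 0" using n_ge by simp
    show "card {t \<in> \<Union> (T ` I). r t = s} \<le> n" for s
    proof (cases "s \<in> R")
      case True
      then have s: "s \<in> V" using QR(4) P_V by blast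
      have "t \<in> nbrs V s" if "t \<in> T H" "r t = s" for t H
        using rT(2)[OF that(1)] that(2) adj_sym adj_V by (auto simp: nbrs_def)
      then have "{t \<in> \<Union> (T ` I). r t = s} \<subseteq> nbrs V s" by blast
      then have "card {t \<in> \<Union> (T ` I). r t = s} \<le> card (nbrs V s)"
        using finite_V by (intro card_mono) auto
      then show ?thesis using degree_le[OF s] by simp
    next
      case False
      then have none: "{t \<in> \<Union> (T ` I). r t = s} = {}" using rT by blast
      show ?thesis unfolding none by simp
    qed
    show "finite (T H)" if "H \<in> I" for H using finT[OF that] .
    show "T H \<inter> T H' = {}" if "H \<in> I" "H' \<in> I" "H \<noteq> H'" for H H' using disjoint[OF that] .
    show "n \<le> card (T H)" if "H \<in> I" for H using that by (simp add: I_def)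
  qed
  then obtain \<phi> where \<phi>: "inj_on \<phi> I" "\<And>H. H \<in> I \<Longrightarrow> \<phi> H \<in> r ` T H" by blast
  \<comment> \<open>A rival of \<open>\<phi> H\<close> is another vertex of \<open>R\<close> attached to the same loaded end block of \<open>H\<close>.\<close>
  define rival where "rival H s \<longleftrightarrow> s \<in> R \<and> \<phi> H \<in> R \<and> s \<noteq> \<phi> H \<and>
    (\<exists>D d d'. loaded H D \<and> d \<in> D \<and> d' \<in> D \<and> d \<sim> \<phi> H \<and> d' \<sim> s)" for H s
  have "\<exists>s. rival H s" if H: "H \<in> I" for H
  proof -
    obtain t where t: "t \<in> T H" "\<phi> H = r t" using \<phi>(2)[OF H] by blast
    then obtain D where D: "loaded H D" "t \<in> D" by (auto simp: T_def)
    have R: "\<phi> H \<in> R" "t \<sim> \<phi> H" using rT[OF t(1)] t(2) by auto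
    obtain d' where d': "d' \<in> D" "\<not> d' \<sim> \<phi> H"
      using loaded_two_neighbours[OF IV[OF H] D(1) R(1)] by blast
    then have "d' \<in> T H" using D(1) by (auto simp: T_def)
    then have r': "r d' \<in> R" "d' \<sim> r d'" using rT by blast+
    then have "r d' \<noteq> \<phi> H" using d'(2) by auto
    then have "rival H (r d')" unfolding rival_def using D R d'(1) r' by blast
    then show ?thesis by blast
  qed
  then obtain \<psi> where \<psi>: "\<And>H. H \<in> I \<Longrightarrow> rival H (\<psi> H)" by metis
  have "\<exists>c. (\<forall>s\<in>R. c s \<in> L s) \<and> (\<forall>H\<in>I. c (\<phi> H) \<noteq> c (\<psi> H))"
  proof (rule functional_graph_coloring[OF finite_sets(3) finI \<phi>(1)])
    show "\<phi> H \<in> R \<and> \<psi> H \<in> R \<and> \<phi> H \<noteq> \<psi> H" if "H \<in> I" for H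
      using \<psi>[OF that] by (auto simp: rival_def)
    show "3 \<le> card (L s)" if "s \<in> R" for s using L3 that QR(4) by blast
  qed
  then obtain c where c: "\<And>s. s \<in> R \<Longrightarrow> c s \<in> L s" "\<And>H. H \<in> I \<Longrightarrow> c (\<phi> H) \<noteq> c (\<psi> H)" by blast
  obtain H where H: "C.closed_in core H" "C.blocked H (free c)"
    using blocked_component_exists[OF c(1) nc] by blast
  have "H \<inter> twin ` Q = {}"
  proof (rule ccontr)
    assume "H \<inter> twin ` Q \<noteq> {}"
    then obtain v where v: "v \<in> Q" "twin v \<in> H" by blast
    then have "card (core_list (twin v)) \<ge> 3" using L3 core_list_twin QR(3) by auto
    then show False
      using card_free_ge[of "twin v" c] card_nbrs_free[OF H v(2)] card_core_nbrs_twin[OF v(1)] by simp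
  qed
  then have "n \<le> card (T H)" using loaded_many_vertices[OF H] by (simp add: T_def)
  then have HI: "H \<in> I" using H by (simp add: I_def C.blocked_def)
  obtain D d d' where D: "loaded H D" "d \<in> D" "d' \<in> D" "d \<sim> \<phi> H" "d' \<sim> \<psi> H"
    and R: "\<psi> H \<in> R" "\<phi> H \<in> R"
    using \<psi>[OF HI] unfolding rival_def by blast
  have "d \<notin> twin ` Q" using D(1,2) by (auto simp: loaded_def)
  moreover have "nbrs R d = {\<phi> H}"
    using D(4) R(2) P_no_common[of "\<phi> H" _ d] QR(4) by (auto simp: nbrs_def)
  ultimately have "free c d = {1..n} - {c (\<phi> H)}" using core_list_non_twin by (simp add: free_def)
  moreover have "c (\<psi> H) \<in> {1..n}" using c(1)[OF R(1)] L_sub R(1) QR(4) by blast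
  ultimately have "c (\<psi> H) \<in> free c d" using c(2)[OF HI] by auto
  then have "c (\<psi> H) \<in> free c d'" using loaded_equal_lists[OF IV[OF HI] H(2) D(1-3)] by blast
  moreover have "\<psi> H \<in> nbrs R d'" using D(5) R(1) by (simp add: nbrs_def)
  ultimately show False by (auto simp: free_def)
qed

end

section \<open>Graphs\<close>

lemma graph_dist_le_walk:
  assumes "wf_digraph G" "pre_digraph.awalk G u p v"
  shows "graph_dist G u v \<le> ereal (real (length p))"
proof -
  interpret wf_digraph G by fact
  have "awalk_cost (\<lambda>_. 1) q = real (length q)" for q by (induction q) simp_all
  then show ?thesis
    using min_cost_le_walk_cost[OF assms(2), of "\<lambda>_. 1"] unfolding graph_dist_def by simp
qed

context graph begin

text \<open>Since there are no parallel arcs, out-degrees count neighbors.\<close>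

lemma card_out_neighbours: "card {w. v \<rightarrow>\<^bsub>G\<^esub> w} = out_degree G v"
proof -
  have "bij_betw (head G) (out_arcs G v) {w. v \<rightarrow>\<^bsub>G\<^esub> w}"
    unfolding bij_betw_def
  proof
    show "inj_on (head G) (out_arcs G v)"
      using no_multi_arcs by (auto simp: inj_on_def arc_to_ends_def)
    show "head G ` out_arcs G v = {w. v \<rightarrow>\<^bsub>G\<^esub> w}"
      by (force simp: arcs_ends_conv)
  qed
  then show ?thesis by (simp add: bij_betw_same_card[symmetric] out_degree_def)
qed

lemma awalk_arc:
  assumes "u \<rightarrow>\<^bsub>G\<^esub> v"
  obtains e where "awalk u [e] v"
proof -
  obtain e where "e \<in> arcs G" "tail G e = u" "head G e = v" using assms by auto
  then have "awalk u [e] v" by (auto simp: awalk_simps)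
  then show ?thesis using that by blast
qed

lemma dist_le:
  shows graph_dist_le_1: "u \<rightarrow>\<^bsub>G\<^esub> v \<Longrightarrow> graph_dist G u v \<le> 1"
    and graph_dist_le_2: "u \<rightarrow>\<^bsub>G\<^esub> a \<Longrightarrow> a \<rightarrow>\<^bsub>G\<^esub> v \<Longrightarrow> graph_dist G u v \<le> 2"
    and graph_dist_le_3: "u \<rightarrow>\<^bsub>G\<^esub> a \<Longrightarrow> a \<rightarrow>\<^bsub>G\<^esub> b \<Longrightarrow> b \<rightarrow>\<^bsub>G\<^esub> v \<Longrightarrow> graph_dist G u v \<le> 3"
proof -
  note le = graph_dist_le_walk[OF wf_digraph_axioms]
  show "graph_dist G u v \<le> 1" if uv: "u \<rightarrow>\<^bsub>G\<^esub> v"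
  proof -
    obtain e where "awalk u [e] v" using awalk_arc[OF uv] .
    from le[OF this] show ?thesis by (simp add: one_ereal_def)
  qed
  show "graph_dist G u v \<le> 2" if ua: "u \<rightarrow>\<^bsub>G\<^esub> a" and av: "a \<rightarrow>\<^bsub>G\<^esub> v"
  proof -
    obtain e where e: "awalk u [e] a" using awalk_arc[OF ua] .
    obtain e' where e': "awalk a [e'] v" using awalk_arc[OF av] .
    from le[OF awalk_appendI[OF e e']] show ?thesis by simp
  qed
  show "graph_dist G u v \<le> 3" if ua: "u \<rightarrow>\<^bsub>G\<^esub> a" and ab: "a \<rightarrow>\<^bsub>G\<^esub> b" and bv: "b \<rightarrow>\<^bsub>G\<^esub> v"
  proof -
    obtain e where e: "awalk u [e] a" using awalk_arc[OF ua] .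
    obtain e' where e': "awalk a [e'] b" using awalk_arc[OF ab] .
    obtain e'' where e'': "awalk b [e''] v" using awalk_arc[OF bv] .
    from le[OF awalk_appendI[OF e awalk_appendI[OF e' e'']]] show ?thesis by simp
  qed
qed

lemma subset_eq_verts_if_closed:
  assumes "Digraph_Component.connected G" "S \<subseteq> verts G" "S \<noteq> {}"
    and "\<And>a b. a \<in> S \<Longrightarrow> a \<rightarrow>\<^bsub>G\<^esub> b \<Longrightarrow> b \<in> S"
  shows "S = verts G"
proof -
  obtain a where a: "a \<in> S" using assms(3) by blast
  have step: "y \<in> S" if "a \<rightarrow>\<^sup>*\<^bsub>G\<^esub> y" for y
    using that by (induction rule: reachable_induct) (use a assms(4) in auto)
  have "y \<in> S" if "y \<in> verts G" for y
  proof (rule step)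
    show "a \<rightarrow>\<^sup>*\<^bsub>G\<^esub> y"
      using symmetric_connected_imp_strongly_connected[OF sym_arcs assms(1)] assms(2) a that by blast
  qed
  then show ?thesis using assms(2) by blast
qed

end

theorem corollary3p1:
  fixes G :: "('a, 'b) pre_digraph" and P :: "'a set" and F :: "'a \<Rightarrow> nat set"
  assumes "graph G"
    and "Digraph_Component.connected G"
    and "max_degree G \<ge> 4"
    and "\<not> complete_graph G"
    and "P \<subseteq> verts G"
    and "\<forall>v\<in>P. F v \<subseteq> {1..max_degree G}"
    and "((\<forall>v\<in>P. card (F v) \<le> max_degree G - 2) \<and>
          (\<forall>u\<in>P. \<forall>v\<in>P. u \<noteq> v \<longrightarrow> graph_dist G u v \<ge> 4)) \<or>
         ((\<forall>v\<in>P. card (F v) \<le> max_degree G - 3) \<and>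
          (\<forall>u\<in>P. \<forall>v\<in>P. u \<noteq> v \<longrightarrow> graph_dist G u v \<ge> 3))"
  shows "\<exists>f. proper_vertex_coloring G (max_degree G) f \<and> (\<forall>v\<in>P. f v \<notin> F v)"
proof -
  interpret G: graph G by fact
  define n where "n = max_degree G"
  define L where "L v = (if v \<in> P then {1..n} - F v else {1..n})" for v
  note n4 = assms(3)[folded n_def]
  have cardL: "card (L v) = n - card (F v)" if "v \<in> P" for v
  proof -
    have "F v \<subseteq> {1..n}" using assms(6) that by (simp add: n_def)
    moreover from this have "finite (F v)" by (rule finite_subset) simp
    ultimately have "card ({1..n} - F v) = card {1..n} - card (F v)"
      by (simp only: card_Diff_subset)
    then show ?thesis using that by (simp add: L_def)
  qed
  have dist3: "graph_dist G u v \<ge> 3" if "u \<in> P" "v \<in> P" "u \<noteq> v" for u v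
    using assms(7)
  proof
    assume "(\<forall>v\<in>P. card (F v) \<le> max_degree G - 2) \<and>
          (\<forall>u\<in>P. \<forall>v\<in>P. u \<noteq> v \<longrightarrow> graph_dist G u v \<ge> 4)"
    then have "graph_dist G u v \<ge> 4" using that by blast
    moreover have "(3::ereal) \<le> 4" by simp
    ultimately show ?thesis by (rule order_trans[rotated])
  qed (use that in blast)
  interpret A: adjacency "\<lambda>u v. u \<rightarrow>\<^bsub>G\<^esub> v"
  proof
    show "v \<rightarrow>\<^bsub>G\<^esub> u" if "u \<rightarrow>\<^bsub>G\<^esub> v" for u v using that arcs_ends_symmetric[OF G.sym_arcs] by blast
    show "\<not> v \<rightarrow>\<^bsub>G\<^esub> v" for v using G.adj_not_same by blast
  qed
  have nbrs: "A.nbrs (verts G) v = {w. v \<rightarrow>\<^bsub>G\<^esub> w}" for v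
    by (auto simp: A.nbrs_def)
  have degree: "card (A.nbrs (verts G) v) \<le> n" if "v \<in> verts G" for v
    unfolding nbrs G.card_out_neighbours n_def max_degree_def using that by (intro Max_ge) auto
  interpret A: forbidden_colors "\<lambda>u v. u \<rightarrow>\<^bsub>G\<^esub> v" "verts G" P n L
  proof
    show "finite (verts G)" by simp
    show "u \<in> verts G" if "u \<rightarrow>\<^bsub>G\<^esub> v" for u v using that by (rule G.adj_in_verts)
    show "4 \<le> n" by (rule n4)
    show "card (A.nbrs (verts G) v) \<le> n" if "v \<in> verts G" for v using degree[OF that] .
    show "card K \<le> n" if K: "K \<subseteq> verts G" "A.clique K" for K
    proof (rule ccontr)
      assume big: "\<not> card K \<le> n"
      have finK: "finite K" using K(1) by (rule finite_subset) simp
      have "K = verts G"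
      proof (rule G.subset_eq_verts_if_closed[OF assms(2) K(1)])
        show "K \<noteq> {}" using big by auto
        fix a b assume ab: "a \<in> K" "a \<rightarrow>\<^bsub>G\<^esub> b"
        have "A.nbrs K a = A.nbrs (verts G) a"
        proof (rule card_seteq)
          show "finite (A.nbrs (verts G) a)" by simp
          show "A.nbrs K a \<subseteq> A.nbrs (verts G) a" using K(1) by (rule A.nbrs_mono)
          show "card (A.nbrs (verts G) a) \<le> card (A.nbrs K a)"
            using A.card_nbrs_clique[OF finK K(2) ab(1)] big degree[of a] K(1) ab(1) by auto
        qed
        moreover have "b \<in> A.nbrs (verts G) a" using ab(2) unfolding nbrs by simp
        ultimately show "b \<in> K" unfolding A.nbrs_def by blast
      qed
      then have "u \<rightarrow>\<^bsub>G\<^esub> v \<longleftrightarrow> u \<in> verts G \<and> v \<in> verts G \<and> u \<noteq> v" for u v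
        using A.cliqueD[OF K(2)] G.adj_in_verts[of u v] A.adj_irrefl[of u] by blast
      then have "arcs_ends G = {(u, v). (u, v) \<in> verts G \<times> verts G \<and> u \<noteq> v}" by auto
      then have "complete_digraph (card (verts G)) G"
        using assms(1) by (simp add: complete_digraph_def)
      then show False using assms(4) by (auto simp: complete_graph_def)
    qed
    show "P \<subseteq> verts G" by fact
    show "L v \<subseteq> {1..n}" if "v \<in> P" for v by (auto simp: L_def)
    show "L v = {1..n}" if "v \<notin> P" for v using that by (simp add: L_def)
    show "2 \<le> card (L v)" if "v \<in> P" for v
      using cardL[OF that] assms(7) that n4 by (force simp: n_def)
    show "\<not> u \<rightarrow>\<^bsub>G\<^esub> v" if uv: "u \<in> P" "v \<in> P" for u v
    proof
      assume adj: "u \<rightarrow>\<^bsub>G\<^esub> v"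
      then have "u \<noteq> v" using A.adj_irrefl by blast
      from order_trans[OF dist3[OF uv this] G.graph_dist_le_1[OF adj]] show False by simp
    qed
    show "u = v" if uv: "u \<in> P" "v \<in> P" and w: "w \<rightarrow>\<^bsub>G\<^esub> u" "w \<rightarrow>\<^bsub>G\<^esub> v" for u v w
    proof (rule ccontr)
      assume "u \<noteq> v"
      from order_trans[OF dist3[OF uv this] G.graph_dist_le_2[OF A.adj_sym[OF w(1)] w(2)]]
      show False by simp
    qed
  qed
  have "\<exists>g. A.list_coloring (verts G) L g"
    using assms(7)
  proof
    assume i: "(\<forall>v\<in>P. card (F v) \<le> max_degree G - 2) \<and>
          (\<forall>u\<in>P. \<forall>v\<in>P. u \<noteq> v \<longrightarrow> graph_dist G u v \<ge> 4)"
    show ?thesis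
    proof (rule A.far_coloring, rule ccontr)
      fix u v a b
      assume uv: "u \<in> P" "v \<in> P" "u \<noteq> v" and walk: "u \<rightarrow>\<^bsub>G\<^esub> a" "a \<rightarrow>\<^bsub>G\<^esub> b" "b \<rightarrow>\<^bsub>G\<^esub> v"
      have "graph_dist G u v \<ge> 4" using i uv by blast
      from order_trans[OF this G.graph_dist_le_3[OF walk]] show False by simp
    qed
  next
    assume "(\<forall>v\<in>P. card (F v) \<le> max_degree G - 3) \<and>
          (\<forall>u\<in>P. \<forall>v\<in>P. u \<noteq> v \<longrightarrow> graph_dist G u v \<ge> 3)"
    then have "3 \<le> card (L v)" if "v \<in> P" for v
      using cardL[OF that] that n4 by (force simp: n_def)
    then show ?thesis by (rule A.three_colors_coloring)
  qed
  then obtain g where g: "A.list_coloring (verts G) L g" by blast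
  have "g v \<in> {1..n}" if "v \<in> verts G" for v
    using g that by (auto simp: A.list_coloring_def L_def split: if_splits)
  moreover have "g u \<noteq> g v" if "u \<rightarrow>\<^bsub>G\<^esub> v" for u v
    using g that G.adj_in_verts[OF that] unfolding A.list_coloring_def by blast
  moreover have "g v \<notin> F v" if "v \<in> P" for v
  proof -
    have "g v \<in> L v" using g that assms(5) unfolding A.list_coloring_def by blast
    then show ?thesis using that by (simp add: L_def)
  qed
  ultimately show ?thesis unfolding proper_vertex_coloring_def n_def by blast
qed

end
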